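(* Let $G,H$ be countable groups. If $G$ and $H$ admit a coarse embedding into a Hilbert space, then so does the standard wreath product $H\wr G$.
   Context: The standard wreath product is $H\wr G=H^{(G)}\rtimes G$, where $H^{(G)}=\bigoplus_{g\in G}H$ and $G$ acts by shifting the copies of $H$. A group $\Gamma$ is endowed with its left canonical coarse structure: $E\subset \Gamma\times\Gamma$ is controlled if and only if $\{g^{-1}h:(g,h)\in E\}$ is finite (for countable $\Gamma$ this is the bounded coarse structure of any left-invariant proper metric). A coarse embedding of $\Gamma$ into a Hilbert space $\mathcal{H}$ is a map $f:\Gamma\to\mathcal{H}$ such that a subset $E\subset \Gamma\times \Gamma$ is controlled if and only if $\sup\{\|f(x)-f(y)\|:(x,y)\in E\}<\infty$. *)

theory Defs
  imports "HOL-Analysis.Analysis" "HOL-Algebra.Product_Groups"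
begin

section \<open>Wreath products\<close>

definition semidirect_product ::
    "('n, 'c) monoid_scheme \<Rightarrow> ('g, 'd) monoid_scheme \<Rightarrow> ('g \<Rightarrow> 'n \<Rightarrow> 'n) \<Rightarrow> ('n \<times> 'g) monoid" where
  "semidirect_product N G \<alpha> =
     \<lparr> carrier = carrier N \<times> carrier G,
       mult = (\<lambda>(m, g) (n, h). (m \<otimes>\<^bsub>N\<^esub> \<alpha> g n, g \<otimes>\<^bsub>G\<^esub> h)),
       one = (\<one>\<^bsub>N\<^esub>, \<one>\<^bsub>G\<^esub>) \<rparr>"

text \<open>Left translation of functions on the group. Elements of \<^const>\<open>sum_group\<close> are
  \<^emph>\<open>extensional\<close> functions on the index set, hence the explicit restriction.\<close>

definition shift :: "('g, 'd) monoid_scheme \<Rightarrow> 'g \<Rightarrow> ('g \<Rightarrow> 'h) \<Rightarrow> 'g \<Rightarrow> 'h" where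
  "shift G g \<phi> = (\<lambda>x\<in>carrier G. \<phi> (inv\<^bsub>G\<^esub> g \<otimes>\<^bsub>G\<^esub> x))"

definition wreath_product ::
    "('h, 'c) monoid_scheme \<Rightarrow> ('g, 'd) monoid_scheme \<Rightarrow> (('g \<Rightarrow> 'h) \<times> 'g) monoid" where
  "wreath_product H G = semidirect_product (sum_group (carrier G) (\<lambda>_. H)) G (shift G)"

lemma group_semidirect_product:
  assumes "group N" "group G"
    and hom: "\<And>g. g \<in> carrier G \<Longrightarrow> \<alpha> g \<in> hom N N"
    and one: "\<And>n. n \<in> carrier N \<Longrightarrow> \<alpha> \<one>\<^bsub>G\<^esub> n = n"
    and mult: "\<And>g h n. \<lbrakk>g \<in> carrier G; h \<in> carrier G; n \<in> carrier N\<rbrakk>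
                 \<Longrightarrow> \<alpha> (g \<otimes>\<^bsub>G\<^esub> h) n = \<alpha> g (\<alpha> h n)"
  shows "group (semidirect_product N G \<alpha>)"
proof -
  interpret N: group N by fact
  interpret G: group G by fact
  have cl: "\<alpha> g n \<in> carrier N" if "g \<in> carrier G" "n \<in> carrier N" for g n
    using hom[OF that(1)] that(2) by (auto simp: hom_def)
  have mu: "\<alpha> g (m \<otimes>\<^bsub>N\<^esub> n) = \<alpha> g m \<otimes>\<^bsub>N\<^esub> \<alpha> g n"
    if "g \<in> carrier G" "m \<in> carrier N" "n \<in> carrier N" for g m n
    using hom[OF that(1)] that by (auto simp: hom_def)
  show ?thesis
  proof (rule groupI)
    fix x assume "x \<in> carrier (semidirect_product N G \<alpha>)"
    then obtain n g where x: "x = (n, g)" "n \<in> carrier N" "g \<in> carrier G"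
      by (auto simp: semidirect_product_def)
    show "\<exists>y\<in>carrier (semidirect_product N G \<alpha>).
            y \<otimes>\<^bsub>semidirect_product N G \<alpha>\<^esub> x = \<one>\<^bsub>semidirect_product N G \<alpha>\<^esub>"
      by (rule bexI[of _ "(inv\<^bsub>N\<^esub> \<alpha> (inv\<^bsub>G\<^esub> g) n, inv\<^bsub>G\<^esub> g)"])
        (use x cl in \<open>auto simp: semidirect_product_def\<close>)
  qed (auto simp: semidirect_product_def cl mu mult one N.m_assoc G.m_assoc)
qed

lemma shift_hom:
  assumes "group G" "group H" "g \<in> carrier G"
  shows "shift G g \<in> hom (sum_group (carrier G) (\<lambda>_. H)) (sum_group (carrier G) (\<lambda>_. H))"
proof -
  interpret G: group G by fact
  interpret H: group H by fact
  have fin: "finite {x \<in> carrier G. \<phi> (inv\<^bsub>G\<^esub> g \<otimes>\<^bsub>G\<^esub> x) \<noteq> \<one>\<^bsub>H\<^esub>}"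
    if "finite {x \<in> carrier G. \<phi> x \<noteq> \<one>\<^bsub>H\<^esub>}" for \<phi>
  proof (rule finite_subset)
    show "{x \<in> carrier G. \<phi> (inv\<^bsub>G\<^esub> g \<otimes>\<^bsub>G\<^esub> x) \<noteq> \<one>\<^bsub>H\<^esub>}
            \<subseteq> (\<lambda>x. g \<otimes>\<^bsub>G\<^esub> x) ` {x \<in> carrier G. \<phi> x \<noteq> \<one>\<^bsub>H\<^esub>}"
    proof
      fix x assume x: "x \<in> {x \<in> carrier G. \<phi> (inv\<^bsub>G\<^esub> g \<otimes>\<^bsub>G\<^esub> x) \<noteq> \<one>\<^bsub>H\<^esub>}"
      then have "x = g \<otimes>\<^bsub>G\<^esub> (inv\<^bsub>G\<^esub> g \<otimes>\<^bsub>G\<^esub> x)"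
        using assms by (simp add: G.m_assoc[symmetric])
      then show "x \<in> (\<lambda>x. g \<otimes>\<^bsub>G\<^esub> x) ` {x \<in> carrier G. \<phi> x \<noteq> \<one>\<^bsub>H\<^esub>}"
        using x assms by blast
    qed
  qed (use that in simp)
  have "(\<lambda>x\<in>carrier G. \<phi> (inv\<^bsub>G\<^esub> g \<otimes>\<^bsub>G\<^esub> x)) \<in> carrier (sum_group (carrier G) (\<lambda>_. H))"
    if "\<phi> \<in> carrier (sum_group (carrier G) (\<lambda>_. H))" for \<phi>
    using that fin[of \<phi>] assms
    by (auto simp: carrier_sum_group PiE_iff conj_commute cong: rev_conj_cong)
  moreover have "(\<lambda>x\<in>carrier G. (\<phi> \<otimes>\<^bsub>sum_group (carrier G) (\<lambda>_. H)\<^esub> \<psi>) (inv\<^bsub>G\<^esub> g \<otimes>\<^bsub>G\<^esub> x))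
      = (\<lambda>x\<in>carrier G. \<phi> (inv\<^bsub>G\<^esub> g \<otimes>\<^bsub>G\<^esub> x)) \<otimes>\<^bsub>sum_group (carrier G) (\<lambda>_. H)\<^esub>
        (\<lambda>x\<in>carrier G. \<psi> (inv\<^bsub>G\<^esub> g \<otimes>\<^bsub>G\<^esub> x))" for \<phi> \<psi>
    using assms by (auto simp: restrict_def fun_eq_iff)
  ultimately show ?thesis
    by (auto simp: hom_def shift_def simp del: mult_sum_group)
qed

lemma group_wreath_product:
  assumes "group G" "group H"
  shows "group (wreath_product H G)"
proof -
  interpret G: group G by fact
  interpret H: group H by fact
  have ext: "\<phi> x = undefined" if "\<phi> \<in> carrier (sum_group (carrier G) (\<lambda>_. H))" "x \<notin> carrier G" for \<phi> x
    using that by (auto simp: carrier_sum_group)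
  show ?thesis
    unfolding wreath_product_def
  proof (rule group_semidirect_product)
    show "shift G \<one>\<^bsub>G\<^esub> \<phi> = \<phi>" if "\<phi> \<in> carrier (sum_group (carrier G) (\<lambda>_. H))" for \<phi>
      using ext[OF that] by (auto simp: shift_def restrict_def fun_eq_iff)
    show "shift G (g \<otimes>\<^bsub>G\<^esub> h) \<phi> = shift G g (shift G h \<phi>)"
      if "g \<in> carrier G" "h \<in> carrier G" for g h \<phi>
      using that by (auto simp: shift_def restrict_def fun_eq_iff G.inv_mult_group G.m_assoc)
  qed (use assms in \<open>auto simp del: mult_sum_group intro: shift_hom\<close>)
qed


section \<open>Coarse embeddings of groups\<close>

definition controlled :: "('g, 'd) monoid_scheme \<Rightarrow> ('g \<times> 'g) set \<Rightarrow> bool" where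
  "controlled G E \<longleftrightarrow> E \<subseteq> carrier G \<times> carrier G \<and> finite {inv\<^bsub>G\<^esub> g \<otimes>\<^bsub>G\<^esub> h |g h. (g, h) \<in> E}"

text \<open>The codomain is an arbitrary real Hilbert space; a complex Hilbert space is one for the real
  part of its inner product, with the same norm. The condition \<^const>\<open>bdd_above\<close> says that the
  supremum is finite (\<^const>\<open>Sup\<close> on \<^typ>\<open>real\<close> is not meaningful for unbounded sets).\<close>

definition coarse_embedding ::
    "('g, 'd) monoid_scheme \<Rightarrow> ('g \<Rightarrow> 'v :: {real_inner, complete_space}) \<Rightarrow> bool" where
  "coarse_embedding G f \<longleftrightarrow>
     (\<forall>E \<subseteq> carrier G \<times> carrier G.
        controlled G E \<longleftrightarrow> bdd_above {norm (f x - f y) |x y. (x, y) \<in> E})"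


section \<open>The Hilbert space of square-summable families\<close>

typedef 'i ell2 = "{f :: 'i \<Rightarrow> real. (\<lambda>i. (f i)\<^sup>2) summable_on UNIV}"
  morphisms ell2_nth Abs_ell2
  by (rule exI[of _ "\<lambda>_. 0"]) simp

text \<open>\<^typ>\<open>nat ell2\<close> is a model of the infinite-dimensional separable Hilbert space. The closed
  linear span of the image of a countable set in any Hilbert space is separable and so embeds
  isometrically into it: a countable group coarsely embeds into some Hilbert space iff it coarsely
  embeds into \<^typ>\<open>nat ell2\<close>.\<close>

setup_lifting type_definition_ell2

lemma summable_on_square_add:
  fixes f g :: "'i \<Rightarrow> real"
  assumes "(\<lambda>i. (f i)\<^sup>2) summable_on A" "(\<lambda>i. (g i)\<^sup>2) summable_on A"
  shows "(\<lambda>i. (f i + g i)\<^sup>2) summable_on A"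
proof (rule summable_on_comparison_test)
  show "(\<lambda>i. 2 * (f i)\<^sup>2 + 2 * (g i)\<^sup>2) summable_on A"
    using assms by (intro summable_on_add summable_on_cmult_right)
  show "(f i + g i)\<^sup>2 \<le> 2 * (f i)\<^sup>2 + 2 * (g i)\<^sup>2" for i
    using sum_squares_bound[of "f i" "g i"] by (simp add: power2_sum)
qed auto

lemma summable_on_square_mult:
  fixes f g :: "'i \<Rightarrow> real"
  assumes "(\<lambda>i. (f i)\<^sup>2) summable_on A" "(\<lambda>i. (g i)\<^sup>2) summable_on A"
  shows "(\<lambda>i. f i * g i) summable_on A"
proof -
  have "(\<lambda>i. (1 / 2) * ((f i + g i)\<^sup>2 + (- ((f i)\<^sup>2 + (g i)\<^sup>2)))) summable_on A"
    by (intro summable_on_cmult_right summable_on_add summable_on_square_add assms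
        summable_on_uminus[THEN iffD2])
  then show ?thesis
    by (simp add: power2_sum)
qed

instantiation ell2 :: (type) real_vector
begin

lift_definition zero_ell2 :: "'a ell2" is "\<lambda>_. 0" by simp
lift_definition plus_ell2 :: "'a ell2 \<Rightarrow> 'a ell2 \<Rightarrow> 'a ell2" is "\<lambda>f g i. f i + g i"
  by (rule summable_on_square_add)
lift_definition uminus_ell2 :: "'a ell2 \<Rightarrow> 'a ell2" is "\<lambda>f i. - f i" by simp
lift_definition minus_ell2 :: "'a ell2 \<Rightarrow> 'a ell2 \<Rightarrow> 'a ell2" is "\<lambda>f g i. f i - g i"
  using summable_on_square_add[of _ UNIV "\<lambda>i. - g i" for g] by simp
lift_definition scaleR_ell2 :: "real \<Rightarrow> 'a ell2 \<Rightarrow> 'a ell2" is "\<lambda>c f i. c * f i"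
  by (simp add: power_mult_distrib summable_on_cmult_right)

instance
  by standard (transfer; simp add: algebra_simps)+

end

instantiation ell2 :: (type) real_inner
begin

lift_definition inner_ell2 :: "'a ell2 \<Rightarrow> 'a ell2 \<Rightarrow> real" is "\<lambda>f g. \<Sum>\<^sub>\<infinity>i. f i * g i" .
definition norm_ell2 :: "'a ell2 \<Rightarrow> real" where "norm_ell2 x = sqrt (x \<bullet> x)"
definition sgn_ell2 :: "'a ell2 \<Rightarrow> 'a ell2" where "sgn_ell2 x = x /\<^sub>R norm x"
definition dist_ell2 :: "'a ell2 \<Rightarrow> 'a ell2 \<Rightarrow> real" where "dist_ell2 x y = norm (x - y)"
definition uniformity_ell2 :: "('a ell2 \<times> 'a ell2) filter" where
  "uniformity_ell2 = (INF e\<in>{0 <..}. principal {(x, y). dist x y < e})"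
definition open_ell2 :: "'a ell2 set \<Rightarrow> bool" where
  "open_ell2 U \<longleftrightarrow> (\<forall>x\<in>U. eventually (\<lambda>(x', y). x' = x \<longrightarrow> y \<in> U) uniformity)"

instance
proof
  fix x y z :: "'a ell2" and r :: real
  show "x \<bullet> y = y \<bullet> x"
    by transfer (simp add: mult.commute)
  show "(x + y) \<bullet> z = x \<bullet> z + y \<bullet> z"
    by transfer (simp add: distrib_right infsum_add summable_on_square_mult)
  show "(r *\<^sub>R x) \<bullet> y = r * (x \<bullet> y)"
    by transfer (simp add: mult.assoc infsum_cmult_right')
  show "0 \<le> x \<bullet> x"
    by transfer (simp add: infsum_nonneg)
  show "x \<bullet> x = 0 \<longleftrightarrow> x = 0"
  proof transfer
    fix f :: "'a \<Rightarrow> real"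
    assume f: "(\<lambda>i. (f i)\<^sup>2) summable_on UNIV"
    have *: "f i = 0" if "(\<Sum>\<^sub>\<infinity>i. f i * f i) = 0" for i
      using nonneg_infsum_le_0D[of "\<lambda>i. (f i)\<^sup>2" UNIV i] f that by (simp add: power2_eq_square)
    have "f = (\<lambda>_. 0)" if "(\<Sum>\<^sub>\<infinity>i. f i * f i) = 0"
      by (rule ext) (rule *[OF that])
    moreover have "(\<Sum>\<^sub>\<infinity>i. f i * f i) = 0" if "f = (\<lambda>_. 0)"
      unfolding that by simp
    ultimately show "(\<Sum>\<^sub>\<infinity>i. f i * f i) = 0 \<longleftrightarrow> f = (\<lambda>_. 0)"
      by iprover
  qed
qed (rule norm_ell2_def sgn_ell2_def dist_ell2_def uniformity_ell2_def open_ell2_def)+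

end

lemma power2_norm_ell2: "(norm x)\<^sup>2 = (\<Sum>\<^sub>\<infinity>i. (ell2_nth x i)\<^sup>2)"
  unfolding power2_norm_eq_inner by transfer (simp add: power2_eq_square)

lemma sum_ell2_le_norm:
  assumes "finite F"
  shows "(\<Sum>i\<in>F. (ell2_nth x i)\<^sup>2) \<le> (norm x)\<^sup>2"
  unfolding power2_norm_ell2
  by (rule finite_sum_le_infsum) (use assms ell2_nth[of x] in auto)

lemma abs_ell2_nth_le_norm: "\<bar>ell2_nth x i\<bar> \<le> norm x"
  using sum_ell2_le_norm[of "{i}" x] by (auto intro: abs_le_square_iff[THEN iffD2, of _ "norm x", simplified])

instance ell2 :: (type) complete_space
proof
  fix X :: "nat \<Rightarrow> 'a ell2"
  assume X: "Cauchy X"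
  define L where "L i = lim (\<lambda>n. ell2_nth (X n) i)" for i
  have L: "(\<lambda>n. ell2_nth (X n) i) \<longlonglongrightarrow> L i" for i
  proof -
    have "Cauchy (\<lambda>n. ell2_nth (X n) i)"
    proof (rule CauchyI)
      fix e :: real assume "0 < e"
      then obtain M where M: "\<forall>m\<ge>M. \<forall>n\<ge>M. norm (X m - X n) < e"
        using CauchyD[OF X] by blast
      have "norm (ell2_nth (X m) i - ell2_nth (X n) i) \<le> norm (X m - X n)" for m n
        using abs_ell2_nth_le_norm[of "X m - X n" i] by (simp add: minus_ell2.rep_eq)
      then show "\<exists>M. \<forall>m\<ge>M. \<forall>n\<ge>M. norm (ell2_nth (X m) i - ell2_nth (X n) i) < e"
        using M by (meson le_less_trans)
    qed
    then show ?thesis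
      by (simp add: L_def Cauchy_convergent_iff convergent_LIMSEQ_iff)
  qed
  have tail: "\<exists>M. \<forall>m\<ge>M. \<forall>F. finite F \<longrightarrow> (\<Sum>i\<in>F. (ell2_nth (X m) i - L i)\<^sup>2) \<le> e\<^sup>2" if e: "e > 0" for e
  proof -
    obtain M where M: "\<forall>m\<ge>M. \<forall>n\<ge>M. norm (X m - X n) < e"
      using CauchyD[OF X e] by blast
    have "(\<Sum>i\<in>F. (ell2_nth (X m) i - L i)\<^sup>2) \<le> e\<^sup>2" if "m \<ge> M" "finite F" for m F
    proof (rule tendsto_upperbound)
      show "(\<lambda>n. \<Sum>i\<in>F. (ell2_nth (X m) i - ell2_nth (X n) i)\<^sup>2)
              \<longlonglongrightarrow> (\<Sum>i\<in>F. (ell2_nth (X m) i - L i)\<^sup>2)"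
        by (intro tendsto_intros L)
      have "(\<Sum>i\<in>F. (ell2_nth (X m) i - ell2_nth (X n) i)\<^sup>2) \<le> e\<^sup>2" if "n \<ge> M" for n
      proof -
        have "(\<Sum>i\<in>F. (ell2_nth (X m) i - ell2_nth (X n) i)\<^sup>2) \<le> (norm (X m - X n))\<^sup>2"
          using sum_ell2_le_norm[OF \<open>finite F\<close>, of "X m - X n"] by (simp add: minus_ell2.rep_eq)
        also have "\<dots> \<le> e\<^sup>2"
          using M \<open>m \<ge> M\<close> that by (intro power_mono) (auto intro: less_imp_le)
        finally show ?thesis .
      qed
      then show "\<forall>\<^sub>F n in sequentially. (\<Sum>i\<in>F. (ell2_nth (X m) i - ell2_nth (X n) i)\<^sup>2) \<le> e\<^sup>2"
        using eventually_sequentially by blast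
    qed simp
    then show ?thesis by blast
  qed
  have diff: "(\<lambda>i. (ell2_nth (X m) i - L i)\<^sup>2) summable_on UNIV"
    if "\<And>F. finite F \<Longrightarrow> (\<Sum>i\<in>F. (ell2_nth (X m) i - L i)\<^sup>2) \<le> c" for m c
    by (rule nonneg_bdd_above_summable_on) (use that in \<open>auto intro!: bdd_aboveI\<close>)
  have "(\<lambda>i. (L i)\<^sup>2) summable_on UNIV"
  proof -
    obtain M where "\<And>F. finite F \<Longrightarrow> (\<Sum>i\<in>F. (ell2_nth (X M) i - L i)\<^sup>2) \<le> 1\<^sup>2"
      using tail[of 1] by auto
    then have "(\<lambda>i. (L i - ell2_nth (X M) i)\<^sup>2) summable_on UNIV"
      using diff by (subst power2_commute) blast
    from summable_on_square_add[OF this, of "ell2_nth (X M)"] show ?thesis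
      using ell2_nth[of "X M"] by simp
  qed
  then have nth: "ell2_nth (Abs_ell2 L) = L"
    by (simp add: Abs_ell2_inverse)
  have "X \<longlonglongrightarrow> Abs_ell2 L"
  proof (rule LIMSEQ_I)
    fix r :: real assume "0 < r"
    then obtain M where M: "\<And>m F. \<lbrakk>m \<ge> M; finite F\<rbrakk> \<Longrightarrow> (\<Sum>i\<in>F. (ell2_nth (X m) i - L i)\<^sup>2) \<le> (r / 2)\<^sup>2"
      using tail[of "r / 2"] by auto
    have "norm (X m - Abs_ell2 L) < r" if "m \<ge> M" for m
    proof -
      have "(norm (X m - Abs_ell2 L))\<^sup>2 \<le> (r / 2)\<^sup>2"
        unfolding power2_norm_ell2 minus_ell2.rep_eq nth
        by (rule infsum_le_finite_sums[OF diff]) (use M[OF that] in auto)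
      then have "norm (X m - Abs_ell2 L) \<le> r / 2"
        by (rule power2_le_imp_le) (use \<open>0 < r\<close> in simp)
      then show ?thesis using \<open>0 < r\<close> by simp
    qed
    then show "\<exists>M. \<forall>m\<ge>M. norm (X m - Abs_ell2 L) < r" by blast
  qed
  then show "convergent X" by (auto simp: convergent_def)
qed

end

theory Submission
  imports Defs
begin

text \<open>A map \<open>f\<close> from \<open>G\<close> to a Hilbert space measures a finite set \<open>F \<subseteq> G\<close> by the mass \<open>W(F)\<close> of the
  half-spaces that split \<open>f(F)\<close>. For two points this is comparable to \<open>\<parallel>f(x) - f(y)\<parallel>\<close>. On the wreath
  product, with \<open>T\<close> consisting of \<open>g\<close>, \<open>h\<close> and the points where \<open>\<phi>\<close> and \<open>\<psi>\<close> differ, the kernel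
  \<open>D((\<phi>, g), (\<psi>, h)) = W(T) + \<Sum>\<^sub>z \<parallel>k(\<phi>(z)) - k(\<psi>(z))\<parallel>\<^sup>2\<close>
  is conditionally negative definite, hence the square of a Hilbert space distance. If \<open>D\<close> is at
  most \<open>R\<close>, the first term confines \<open>g\<inverse>h\<close> and the translate by \<open>g\<inverse>\<close> of the set where \<open>\<phi>\<close> and \<open>\<psi>\<close>
  differ to a finite set, and the second confines the values of \<open>\<phi>\<inverse>\<psi>\<close>. To avoid Gaussian measures,
  the random half-spaces are taken orthogonal to random sign vectors; this suffices because a
  countable set of Hilbert space vectors has finitely supported coordinates in some orthonormal
  basis.\<close>

section \<open>Positive semidefinite and conditionally negative kernels\<close>

definition psd_on :: "'a set \<Rightarrow> ('a \<Rightarrow> 'a \<Rightarrow> real) \<Rightarrow> bool" where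
  "psd_on X K \<longleftrightarrow> (\<forall>x\<in>X. \<forall>y\<in>X. K x y = K y x) \<and>
     (\<forall>A c. finite A \<longrightarrow> A \<subseteq> X \<longrightarrow> 0 \<le> (\<Sum>x\<in>A. \<Sum>y\<in>A. c x * c y * K x y))"

definition cnd_on :: "'a set \<Rightarrow> ('a \<Rightarrow> 'a \<Rightarrow> real) \<Rightarrow> bool" where
  "cnd_on X D \<longleftrightarrow> (\<forall>x\<in>X. D x x = 0) \<and> (\<forall>x\<in>X. \<forall>y\<in>X. D x y = D y x) \<and>
     (\<forall>A c. finite A \<longrightarrow> A \<subseteq> X \<longrightarrow> sum c A = 0 \<longrightarrow> (\<Sum>x\<in>A. \<Sum>y\<in>A. c x * c y * D x y) \<le> 0)"

lemma psd_onD: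
  assumes "psd_on X K"
  shows "x \<in> X \<Longrightarrow> y \<in> X \<Longrightarrow> K x y = K y x"
    and "finite A \<Longrightarrow> A \<subseteq> X \<Longrightarrow> 0 \<le> (\<Sum>x\<in>A. \<Sum>y\<in>A. c x * c y * K x y)"
  using assms unfolding psd_on_def by blast+

lemma cnd_onD:
  assumes "cnd_on X D"
  shows "x \<in> X \<Longrightarrow> D x x = 0"
    and "x \<in> X \<Longrightarrow> y \<in> X \<Longrightarrow> D x y = D y x"
    and "finite A \<Longrightarrow> A \<subseteq> X \<Longrightarrow> sum c A = 0 \<Longrightarrow> (\<Sum>x\<in>A. \<Sum>y\<in>A. c x * c y * D x y) \<le> 0"
  using assms unfolding cnd_on_def by blast+

section \<open>Elimination in positive semidefinite kernels\<close>

lemma psd_on_diag_nonneg: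
  assumes "psd_on X K" "x \<in> X"
  shows "0 \<le> K x x"
  using psd_onD(2)[OF assms(1), of "{x}" "\<lambda>_. 1"] assms(2) by simp

text \<open>On vectors supported at \<open>x\<close> and \<open>j\<close> with weight one at
  \<open>x\<close>, the form is affine in the weight \<open>t\<close> of \<open>j\<close>, because
  its quadratic term \<open>K j j\<close> vanishes. An affine function that is nonnegative for all
  \<open>t\<close> has slope zero.\<close>

lemma psd_on_zero_diag:
  assumes K: "psd_on X K" and xj: "x \<in> X" "j \<in> X" and 0: "K j j = 0"
  shows "K x j = 0"
proof (rule ccontr)
  assume ne: "K x j \<noteq> 0"
  then have "x \<noteq> j" using 0 by auto
  \<comment> \<open>At this weight the affine function takes the value -1.\<close>
  define t where "t = - (K x x + 1) / (2 * K x j)"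
  have "0 \<le> K x x + t * K x j + t * K j x"
    using psd_onD(2)[OF K, of "{x, j}" "\<lambda>y. if y = j then t else 1"] xj 0 \<open>x \<noteq> j\<close> by simp
  also have "K j x = K x j"
    using psd_onD(1)[OF K] xj by simp
  also have "K x x + t * K x j + t * K x j = - 1"
    using ne by (simp add: t_def field_simps)
  finally show False by simp
qed

text \<open>Adding weight \<open>t\<close> at \<open>j\<close> to a finitely supported vector makes
  the form a quadratic polynomial in \<open>t\<close>, whose minimum is the value of the new form.
  If \<open>K j j = 0\<close>, division by zero gives zero and the kernel stays as it is.\<close>

lemma psd_on_schur_complement:
  assumes K: "psd_on X K" and j: "j \<in> X"
  shows "psd_on X (\<lambda>x y. K x y - K x j * K j y / K j j)"
  unfolding psd_on_def
proof (intro conjI ballI allI impI)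
  show "K x y - K x j * K j y / K j j = K y x - K y j * K j x / K j j" if "x \<in> X" "y \<in> X" for x y
    using psd_onD(1)[OF K] that j by (simp add: mult.commute)
next
  fix A :: "'a set" and c :: "'a \<Rightarrow> real"
  assume A: "finite A" "A \<subseteq> X"
  define B where "B = insert j A"
  define d where "d x = (if x \<in> A then c x else 0)" for x
  define Q where "Q = (\<Sum>x\<in>A. \<Sum>y\<in>A. c x * c y * K x y)"
  define b where "b = (\<Sum>x\<in>A. c x * K x j)"
  have B: "finite B" "B \<subseteq> X" "j \<in> B" using A j by (auto simp: B_def)
  have b': "b = (\<Sum>x\<in>A. c x * K j x)"
    unfolding b_def using psd_onD(1)[OF K] A j by (intro sum.cong) auto
  have restr: "(\<Sum>x\<in>B. d x * g x) = (\<Sum>x\<in>A. c x * g x)" for g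
    unfolding d_def B_def using A
    by (intro sum.mono_neutral_cong_right) auto
  have Q: "(\<Sum>x\<in>B. \<Sum>y\<in>B. d x * d y * K x y) = Q"
    by (simp add: Q_def mult.assoc restr flip: sum_distrib_left)
  have "0 \<le> Q + 2 * t * b + t\<^sup>2 * K j j" for t
  proof -
    define e :: "'a \<Rightarrow> real" where "e x = of_bool (x = j)" for x
    have e: "(\<Sum>x\<in>B. e x * g x) = g j" for g
      unfolding e_def using B by simp
    have "0 \<le> (\<Sum>x\<in>B. \<Sum>y\<in>B. (d x + t * e x) * (d y + t * e y) * K x y)"
      using psd_onD(2)[OF K B(1,2)] .
    also have "\<dots> = (\<Sum>x\<in>B. \<Sum>y\<in>B. d x * d y * K x y) + t * (\<Sum>x\<in>B. d x * (\<Sum>y\<in>B. e y * K x y))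
        + t * (\<Sum>x\<in>B. e x * (\<Sum>y\<in>B. d y * K x y)) + t\<^sup>2 * (\<Sum>x\<in>B. e x * (\<Sum>y\<in>B. e y * K x y))"
      by (simp add: sum_distrib_left algebra_simps sum.distrib power2_eq_square)
    also have "\<dots> = Q + 2 * t * b + t\<^sup>2 * K j j"
      by (simp add: e restr Q b_def[symmetric] b'[symmetric])
    finally show ?thesis .
  qed
  note quadratic = this
  have "(\<Sum>x\<in>A. \<Sum>y\<in>A. c x * c y * (K x y - K x j * K j y / K j j))
      = Q - (\<Sum>x\<in>A. c x * K x j) * (\<Sum>y\<in>A. c y * K j y) / K j j"
    by (simp add: Q_def sum_product sum_divide_distrib right_diff_distrib sum_subtractf mult_ac)
  also have "\<dots> = Q - b\<^sup>2 / K j j"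
    by (simp add: power2_eq_square b_def[symmetric] b'[symmetric])
  also have "\<dots> \<ge> 0"
  proof (cases "K j j = 0")
    case True
    then show ?thesis using quadratic[of 0] by simp
  next
    case False
    then show ?thesis using quadratic[of "- b / K j j"]
      by (simp add: field_simps power2_eq_square)
  qed
  finally show "0 \<le> (\<Sum>x\<in>A. \<Sum>y\<in>A. c x * c y * (K x y - K x j * K j y / K j j))" .
qed

text \<open>What remains of \<open>K\<close> after \<open>n\<close> steps of symmetric Gaussian
  elimination with pivots \<open>e 0\<close>, \<open>e 1\<close> and so on. The sequence may repeat
  points: for a positive semidefinite \<open>K\<close> the diagonal entry at a repeated pivot is
  zero, and division by zero makes that step idle.\<close>

primrec schur_residual :: "(nat \<Rightarrow> 'a) \<Rightarrow> ('a \<Rightarrow> 'a \<Rightarrow> real) \<Rightarrow> nat \<Rightarrow> 'a \<Rightarrow> 'a \<Rightarrow> real" where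
  "schur_residual e K 0 = K"
| "schur_residual e K (Suc n) = (\<lambda>x y. schur_residual e K n x y -
     schur_residual e K n x (e n) * schur_residual e K n (e n) y / schur_residual e K n (e n) (e n))"

lemma psd_on_schur_residual:
  assumes "psd_on X K" "range e \<subseteq> X"
  shows "psd_on X (schur_residual e K n)"
  using assms by (induction n) (auto intro!: psd_on_schur_complement)

text \<open>A step with nonzero pivot clears the row and column of the pivot; with zero pivot they
  were already zero by \<open>psd_on_zero_diag\<close>. Later steps keep them zero, as every
  correction term contains a factor from the cleared row or column.\<close>

lemma schur_residual_eq_0:
  assumes K: "psd_on X K" and e: "range e \<subseteq> X" and x: "x \<in> X" and "i < n"
  shows "schur_residual e K n x (e i) = 0" "schur_residual e K n (e i) x = 0"
proof -
  have ei: "e i \<in> X" for i using e by auto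
  have *: "schur_residual e K n x (e i) = 0" if "i < n" "x \<in> X" for n i x
    using that
  proof (induction n arbitrary: i x)
    case (Suc n)
    let ?K = "schur_residual e K n"
    show ?case
    proof (cases "i = n")
      case True
      have "?K x (e n) = 0" if "?K (e n) (e n) = 0"
        using psd_on_zero_diag[OF psd_on_schur_residual[OF K e]] that Suc.prems ei by blast
      then show ?thesis using True by auto
    next
      case False
      then show ?thesis using Suc ei by simp
    qed
  qed simp
  show "schur_residual e K n x (e i) = 0" using * assms by blast
  then show "schur_residual e K n (e i) x = 0"
    using psd_onD(1)[OF psd_on_schur_residual[OF K e]] x ei by metis
qed

text \<open>Cholesky decomposition: the coordinates of \<^term>\<open>x\<close> are read off from the successive Schur
  complements, and all but finitely many vanish because \<^term>\<open>x\<close> is eliminated at some stage.\<close>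

lemma psd_on_countable_representation:
  assumes K: "psd_on X K" and X: "countable X"
  obtains v :: "'a \<Rightarrow> nat \<Rightarrow> real" and N :: "'a \<Rightarrow> nat" where
    "\<And>x i. \<lbrakk>x \<in> X; N x \<le> i\<rbrakk> \<Longrightarrow> v x i = 0"
    "\<And>x y n. \<lbrakk>x \<in> X; y \<in> X; N x \<le> n\<rbrakk> \<Longrightarrow> K x y = (\<Sum>i<n. v x i * v y i)"
proof (cases "X = {}")
  case True
  then show ?thesis using that by auto
next
  case False
  define e where "e = from_nat_into X"
  have e: "range e \<subseteq> X" unfolding e_def using False by (simp add: range_from_nat_into_subset)
  \<comment> \<open>The successor counts the step in which \<open>x\<close> itself is the
    pivot.\<close>
  define N where "N x = Suc (to_nat_on X x)" for x
  define R where "R = schur_residual e K"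
  \<comment> \<open>Column \<open>i\<close> of the Cholesky factor; a zero pivot yields the
    coordinate 0, again by division by zero.\<close>
  define v where "v x i = R i x (e i) / sqrt (R i (e i) (e i))" for x i
  have R0: "R i x y = 0 \<and> R i y x = 0" if "x \<in> X" "y \<in> X" "N x \<le> i" for x y i
  proof -
    have "x = e (to_nat_on X x)" unfolding e_def using that X by simp
    moreover have "to_nat_on X x < i" using that by (simp add: N_def)
    ultimately show ?thesis
      unfolding R_def using schur_residual_eq_0[OF K e] that by metis
  qed
  have decomp: "K x y = (\<Sum>i<n. v x i * v y i) + R n x y" if "x \<in> X" "y \<in> X" for x y n
  proof (induction n)
    case 0
    then show ?case by (simp add: R_def)
  next
    case (Suc n)
    have ps: "psd_on X (R n)" unfolding R_def by (rule psd_on_schur_residual[OF K e])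
    have en: "e n \<in> X" using e by auto
    have "v x n * v y n = R n x (e n) * R n y (e n) / \<bar>R n (e n) (e n)\<bar>"
      by (simp add: v_def)
    also have "\<dots> = R n x (e n) * R n (e n) y / R n (e n) (e n)"
      using psd_on_diag_nonneg[OF ps en] psd_onD(1)[OF ps en that(2)] by simp
    finally show ?case using Suc by (simp add: R_def)
  qed
  show ?thesis
  proof (rule that[of N v])
    show "v x i = 0" if "x \<in> X" "N x \<le> i" for x i
      using R0[of x "e i" i] e that by (auto simp: v_def)
    show "K x y = (\<Sum>i<n. v x i * v y i)" if "x \<in> X" "y \<in> X" "N x \<le> n" for x y n
      using decomp[of x y n] R0 that by simp
  qed
qed

section \<open>Conditionally negative kernels as squared distances\<close>

text \<open>For a squared distance \<open>D\<close> this is the Gram matrix with origin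
  \<open>p\<close>. In general its form at \<open>c\<close> is -1/2 times the form of
  \<open>D\<close> at the vector of total weight zero obtained from \<open>c\<close> by subtracting
  \<open>sum c A\<close> at \<open>p\<close>.\<close>

lemma cnd_on_imp_psd_on:
  assumes D: "cnd_on X D" and p: "p \<in> X"
  shows "psd_on X (\<lambda>x y. (D x p + D p y - D x y) / 2)"
  unfolding psd_on_def
proof (intro conjI ballI allI impI)
  show "(D x p + D p y - D x y) / 2 = (D y p + D p x - D y x) / 2" if "x \<in> X" "y \<in> X" for x y
    using cnd_onD(2)[OF D] that p by simp
next
  fix A :: "'a set" and c :: "'a \<Rightarrow> real"
  assume A: "finite A" "A \<subseteq> X"
  define B where "B = insert p A"
  \<comment> \<open>The point \<open>p\<close> may already belong to \<open>A\<close>; its two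
    weights then add up.\<close>
  define e where "e x = (if x \<in> A then c x else 0) - of_bool (x = p) * sum c A" for x
  have B: "finite B" "B \<subseteq> X" "p \<in> B" using A p by (auto simp: B_def)
  have e: "(\<Sum>x\<in>B. e x * g x) = (\<Sum>x\<in>A. c x * g x) - sum c A * g p" for g
  proof -
    have "(\<Sum>x\<in>B. (if x \<in> A then c x else 0) * g x) = (\<Sum>x\<in>A. c x * g x)"
      unfolding B_def using A by (intro sum.mono_neutral_cong_right) auto
    moreover have "(\<Sum>x\<in>B. of_bool (x = p) * sum c A * g x) = sum c A * g p"
      using B by (simp add: mult.assoc)
    ultimately show ?thesis
      by (simp add: e_def left_diff_distrib sum_subtractf)
  qed
  define Q where "Q = (\<Sum>x\<in>A. \<Sum>y\<in>A. c x * c y * D x y)"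
  define b where "b = (\<Sum>x\<in>A. c x * D x p)"
  have b': "b = (\<Sum>x\<in>A. c x * D p x)"
    unfolding b_def using cnd_onD(2)[OF D] A p by (intro sum.cong) auto
  have "sum e B = 0" using e[of "\<lambda>_. 1"] by simp
  then have "(\<Sum>x\<in>B. \<Sum>y\<in>B. e x * e y * D x y) \<le> 0"
    using cnd_onD(3)[OF D B(1,2)] by blast
  also have "(\<Sum>x\<in>B. \<Sum>y\<in>B. e x * e y * D x y) = (\<Sum>x\<in>B. e x * (\<Sum>y\<in>B. e y * D x y))"
    by (simp add: sum_distrib_left mult.assoc)
  also have "\<dots> = (\<Sum>x\<in>A. c x * ((\<Sum>y\<in>A. c y * D x y) - sum c A * D x p)) - sum c A * b"
    unfolding e using cnd_onD(1)[OF D p] by (simp add: b')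
  also have "\<dots> = Q - (\<Sum>x\<in>A. sum c A * (c x * D x p)) - sum c A * b"
    unfolding right_diff_distrib sum_subtractf by (simp add: Q_def sum_distrib_left mult_ac)
  also have "\<dots> = Q - 2 * (sum c A * b)"
    by (simp add: b_def sum_distrib_left sum_negf)
  finally have "Q \<le> 2 * (sum c A * b)" by simp
  moreover have "(\<Sum>x\<in>A. \<Sum>y\<in>A. c x * c y * ((D x p + D p y - D x y) / 2)) =
      ((\<Sum>x\<in>A. \<Sum>y\<in>A. (c x * D x p) * c y) + (\<Sum>x\<in>A. \<Sum>y\<in>A. c x * (c y * D p y)) - Q) / 2"
    by (simp add: Q_def sum_divide_distrib sum.distrib[symmetric] sum_subtractf[symmetric]
        algebra_simps)
  moreover have "\<dots> = (b * sum c A + sum c A * b - Q) / 2"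
    by (simp add: sum_product[symmetric] b_def[symmetric] b'[symmetric])
  ultimately show "0 \<le> (\<Sum>x\<in>A. \<Sum>y\<in>A. c x * c y * ((D x p + D p y - D x y) / 2))"
    by (simp add: mult.commute)
qed

text \<open>Polarisation recovers \<open>D\<close> from the Gram matrix based at a point
  \<open>p\<close>. The bound \<open>N\<close> on the supports is kept because averages over
  finitely many signs see only finitely many coordinates.\<close>

lemma cnd_on_countable_representation:
  assumes D: "cnd_on X D" and X: "countable X"
  obtains v :: "'a \<Rightarrow> nat \<Rightarrow> real" and N :: "'a \<Rightarrow> nat" where
    "\<And>x i. \<lbrakk>x \<in> X; N x \<le> i\<rbrakk> \<Longrightarrow> v x i = 0"
    "\<And>x y n. \<lbrakk>x \<in> X; y \<in> X; N x \<le> n; N y \<le> n\<rbrakk> \<Longrightarrow> D x y = (\<Sum>i<n. (v x i - v y i)\<^sup>2)"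
proof (cases "X = {}")
  case True
  then show ?thesis using that by auto
next
  case False
  then obtain p where p: "p \<in> X" by auto
  define K where "K x y = (D x p + D p y - D x y) / 2" for x y
  have psd: "psd_on X K"
    using cnd_on_imp_psd_on[OF D p] by (simp add: K_def[abs_def])
  obtain v :: "'a \<Rightarrow> nat \<Rightarrow> real" and N :: "'a \<Rightarrow> nat" where v: "\<And>x i. \<lbrakk>x \<in> X; N x \<le> i\<rbrakk> \<Longrightarrow> v x i = 0"
    and K: "\<And>x y n. \<lbrakk>x \<in> X; y \<in> X; N x \<le> n\<rbrakk> \<Longrightarrow> K x y = (\<Sum>i<n. v x i * v y i)"
    by (rule psd_on_countable_representation[OF psd X]) blast
  show ?thesis
  proof (rule that[of N v])
    show "v x i = 0" if "x \<in> X" "N x \<le> i" for x i using v that by blast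
    show "D x y = (\<Sum>i<n. (v x i - v y i)\<^sup>2)" if "x \<in> X" "y \<in> X" "N x \<le> n" "N y \<le> n" for x y n
    proof -
      have "D x y = K x x + K y y - 2 * K x y"
        using cnd_onD(1,2)[OF D] p that by (simp add: K_def field_simps)
      also have "\<dots> = (\<Sum>i<n. (v x i - v y i)\<^sup>2)"
        unfolding K[OF that(1,1,3)] K[OF that(2,2,4)] K[OF that(1,2,3)] sum_distrib_left
          sum.distrib[symmetric] sum_subtractf[symmetric]
        by (intro sum.cong) (simp_all add: power2_eq_square algebra_simps)
      finally show ?thesis .
    qed
  qed
qed

text \<open>This form of Schoenberg's theorem turns the kernel built on the wreath product into a
  map to Hilbert space.\<close>

lemma cnd_on_ell2_representation:
  assumes D: "cnd_on X D" and X: "countable X"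
  obtains F :: "'a \<Rightarrow> nat ell2" where "\<And>x y. \<lbrakk>x \<in> X; y \<in> X\<rbrakk> \<Longrightarrow> (norm (F x - F y))\<^sup>2 = D x y"
proof -
  obtain v :: "'a \<Rightarrow> nat \<Rightarrow> real" and N :: "'a \<Rightarrow> nat" where v: "\<And>x i. \<lbrakk>x \<in> X; N x \<le> i\<rbrakk> \<Longrightarrow> v x i = 0"
    and D_eq: "\<And>x y n. \<lbrakk>x \<in> X; y \<in> X; N x \<le> n; N y \<le> n\<rbrakk> \<Longrightarrow> D x y = (\<Sum>i<n. (v x i - v y i)\<^sup>2)"
    by (rule cnd_on_countable_representation[OF D X]) blast
  have nth: "ell2_nth (Abs_ell2 (v x)) = v x" if "x \<in> X" for x
  proof (rule Abs_ell2_inverse)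
    have "(\<lambda>i. (v x i)\<^sup>2) summable_on {..<N x}" by simp
    then have "(\<lambda>i. (v x i)\<^sup>2) summable_on UNIV"
      by (rule summable_on_cong_neutral[THEN iffD1, rotated -1]) (use v[OF that] in \<open>auto simp: not_less\<close>)
    then show "v x \<in> {f. (\<lambda>i. (f i)\<^sup>2) summable_on UNIV}" by simp
  qed
  show ?thesis
  proof (rule that[of "\<lambda>x. Abs_ell2 (v x)"])
    fix x y assume xy: "x \<in> X" "y \<in> X"
    define n where "n = max (N x) (N y)"
    have "(norm (Abs_ell2 (v x) - Abs_ell2 (v y)))\<^sup>2 = (\<Sum>\<^sub>\<infinity>i. (v x i - v y i)\<^sup>2)"
      using xy by (simp add: power2_norm_ell2 minus_ell2.rep_eq nth)
    also have "\<dots> = (\<Sum>\<^sub>\<infinity>i\<in>{..<n}. (v x i - v y i)\<^sup>2)"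
      by (rule infsum_cong_neutral) (use v xy in \<open>auto simp: n_def not_less\<close>)
    also have "\<dots> = D x y"
      using D_eq[OF xy, of n] by (simp add: n_def)
    finally show "(norm (Abs_ell2 (v x) - Abs_ell2 (v y)))\<^sup>2 = D x y" .
  qed
qed

text \<open>After expanding the squares, the terms in one variable are killed by
  \<open>sum c A = 0\<close>, and -2 times the squared norm of \<open>S\<close> remains.\<close>

lemma cnd_on_norm_diff:
  fixes f :: "'a \<Rightarrow> 'u :: real_inner"
  shows "cnd_on X (\<lambda>x y. (norm (f x - f y))\<^sup>2)"
  unfolding cnd_on_def
proof (intro conjI ballI allI impI)
  fix A :: "'a set" and c :: "'a \<Rightarrow> real"
  assume c: "sum c A = 0"
  define S where "S = (\<Sum>x\<in>A. c x *\<^sub>R f x)"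
  have "(\<Sum>x\<in>A. \<Sum>y\<in>A. c x * c y * (norm (f x - f y))\<^sup>2) =
     (\<Sum>x\<in>A. \<Sum>y\<in>A. c y * (c x * (norm (f x))\<^sup>2)) + (\<Sum>x\<in>A. \<Sum>y\<in>A. c x * (c y * (norm (f y))\<^sup>2))
     - 2 * (\<Sum>x\<in>A. \<Sum>y\<in>A. c x * c y * (f x \<bullet> f y))"
    unfolding sum_distrib_left sum.distrib[symmetric] sum_subtractf[symmetric]
    by (intro sum.cong) (simp_all add: power2_norm_eq_inner inner_diff_left inner_diff_right
        inner_commute algebra_simps)
  also have "(\<Sum>x\<in>A. \<Sum>y\<in>A. c y * (c x * (norm (f x))\<^sup>2)) = 0"
    by (simp add: c flip: sum_distrib_right)
  also have "(\<Sum>x\<in>A. \<Sum>y\<in>A. c x * (c y * (norm (f y))\<^sup>2)) = 0"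
    by (simp add: c flip: sum_distrib_left sum_distrib_right)
  also have "(\<Sum>x\<in>A. \<Sum>y\<in>A. c x * c y * (f x \<bullet> f y)) = S \<bullet> S"
    by (simp add: S_def inner_sum_left inner_sum_right sum_distrib_left mult_ac inner_commute)
  finally show "(\<Sum>x\<in>A. \<Sum>y\<in>A. c x * c y * (norm (f x - f y))\<^sup>2) \<le> 0" by simp
qed (auto simp: norm_minus_commute)

lemma cnd_on_add:
  assumes "cnd_on X D" "cnd_on X E"
  shows "cnd_on X (\<lambda>x y. D x y + E x y)"
  unfolding cnd_on_def
proof (intro conjI ballI allI impI)
  fix A :: "'a set" and c :: "'a \<Rightarrow> real"
  assume "finite A" "A \<subseteq> X" "sum c A = 0"
  from cnd_onD(3)[OF assms(1) this] cnd_onD(3)[OF assms(2) this]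
  show "(\<Sum>x\<in>A. \<Sum>y\<in>A. c x * c y * (D x y + E x y)) \<le> 0"
    by (simp add: distrib_left sum.distrib)
qed (use cnd_onD[OF assms(1)] cnd_onD[OF assms(2)] in auto)


section \<open>Averages over random signs\<close>

text \<open>The expectation over independent uniform signs in the coordinates below
  \<open>n\<close>, the others being fixed at 1. The recursion conditions on the last sign and
  avoids any probability space.\<close>

primrec sgn_avg :: "nat \<Rightarrow> ((nat \<Rightarrow> real) \<Rightarrow> real) \<Rightarrow> real" where
  "sgn_avg 0 \<Phi> = \<Phi> (\<lambda>_. 1)"
| "sgn_avg (Suc n) \<Phi> = (sgn_avg n (\<lambda>\<epsilon>. \<Phi> (\<epsilon>(n := 1))) + sgn_avg n (\<lambda>\<epsilon>. \<Phi> (\<epsilon>(n := - 1)))) / 2"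

lemma sgn_avg_const: "sgn_avg n (\<lambda>_. c) = c"
  by (induction n) auto

lemma sgn_avg_add: "sgn_avg n (\<lambda>\<epsilon>. \<Phi> \<epsilon> + \<Psi> \<epsilon>) = sgn_avg n \<Phi> + sgn_avg n \<Psi>"
  by (induction n arbitrary: \<Phi> \<Psi>) (auto simp: field_simps)

lemma sgn_avg_cmult: "sgn_avg n (\<lambda>\<epsilon>. c * \<Phi> \<epsilon>) = c * sgn_avg n \<Phi>"
  by (induction n arbitrary: \<Phi>) (auto simp: field_simps)

lemma sgn_avg_sum: "finite A \<Longrightarrow> sgn_avg n (\<lambda>\<epsilon>. \<Sum>x\<in>A. \<Phi> x \<epsilon>) = (\<Sum>x\<in>A. sgn_avg n (\<Phi> x))"
  by (induction A rule: finite_induct) (auto simp: sgn_avg_const sgn_avg_add)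

lemma sgn_avg_mono: "(\<And>\<epsilon>. \<Phi> \<epsilon> \<le> \<Psi> \<epsilon>) \<Longrightarrow> sgn_avg n \<Phi> \<le> sgn_avg n \<Psi>"
proof (induction n arbitrary: \<Phi> \<Psi>)
  case (Suc n)
  show ?case
    using Suc.IH[of "\<lambda>\<epsilon>. \<Phi> (\<epsilon>(n := 1))" "\<lambda>\<epsilon>. \<Psi> (\<epsilon>(n := 1))"]
      Suc.IH[of "\<lambda>\<epsilon>. \<Phi> (\<epsilon>(n := - 1))" "\<lambda>\<epsilon>. \<Psi> (\<epsilon>(n := - 1))"] Suc.prems
    by simp
qed simp

text \<open>Irrelevant signs average out, so functions with different numbers of relevant signs can
  be averaged over one common length.\<close>

lemma sgn_avg_independent:
  assumes "n \<le> m" and "\<And>\<epsilon> i t. n \<le> i \<Longrightarrow> \<Phi> (\<epsilon>(i := t)) = \<Phi> \<epsilon>"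
  shows "sgn_avg m \<Phi> = sgn_avg n \<Phi>"
  using assms(1) by (induction m rule: dec_induct) (simp_all add: assms(2))

section \<open>Moments of random linear forms\<close>

lemma sum_fun_upd_lessThan: "(\<Sum>i<n. (\<epsilon>(n := t)) i * a i) = (\<Sum>i<n. \<epsilon> i * a i :: real)" for n :: nat
  by (intro sum.cong) auto

lemma sgn_avg_linear_form_Suc:
  "sgn_avg (Suc n) (\<lambda>\<epsilon>. g (\<Sum>i<Suc n. \<epsilon> i * a i)) =
   sgn_avg n (\<lambda>\<epsilon>. (g ((\<Sum>i<n. \<epsilon> i * a i) + a n) + g ((\<Sum>i<n. \<epsilon> i * a i) - a n)) / 2)"
  using sgn_avg_cmult[of n "1 / 2"]
  by (simp add: sum_fun_upd_lessThan sgn_avg_add del: fun_upd_apply) (simp add: sgn_avg_add)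

lemma sgn_avg_power2: "sgn_avg n (\<lambda>\<epsilon>. (\<Sum>i<n. \<epsilon> i * a i)\<^sup>2) = (\<Sum>i<n. (a i)\<^sup>2)"
proof (induction n)
  case (Suc n)
  have "sgn_avg (Suc n) (\<lambda>\<epsilon>. (\<Sum>i<Suc n. \<epsilon> i * a i)\<^sup>2) =
        sgn_avg n (\<lambda>\<epsilon>. (\<Sum>i<n. \<epsilon> i * a i)\<^sup>2 + (a n)\<^sup>2)"
    unfolding sgn_avg_linear_form_Suc[where g = "\<lambda>s. s\<^sup>2"]
    by (rule arg_cong[of _ _ "sgn_avg n"]) (simp add: fun_eq_iff power2_eq_square algebra_simps)
  then show ?case using Suc by (simp add: sgn_avg_add sgn_avg_const)
qed simp

text \<open>The fourth moment bound behind Khinchine's inequality. If \<open>s\<close> is the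
  shorter form and \<open>b = a n\<close>, averaging over the last sign leaves
  \<open>s^4 + 6 * b^2 * s^2 + b^4\<close>, since the odd powers of \<open>b\<close> cancel.\<close>

lemma sgn_avg_power4: "sgn_avg n (\<lambda>\<epsilon>. (\<Sum>i<n. \<epsilon> i * a i) ^ 4) \<le> 3 * (\<Sum>i<n. (a i)\<^sup>2)\<^sup>2"
proof (induction n)
  case (Suc n)
  define v where "v = (\<Sum>i<n. (a i)\<^sup>2)"
  have "sgn_avg (Suc n) (\<lambda>\<epsilon>. (\<Sum>i<Suc n. \<epsilon> i * a i) ^ 4) =
        sgn_avg n (\<lambda>\<epsilon>. (\<Sum>i<n. \<epsilon> i * a i) ^ 4 + (6 * (a n)\<^sup>2 * (\<Sum>i<n. \<epsilon> i * a i)\<^sup>2 + (a n) ^ 4))"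
    unfolding sgn_avg_linear_form_Suc[where g = "\<lambda>s. s ^ 4"]
    by (rule arg_cong[of _ _ "sgn_avg n"])
      (simp add: fun_eq_iff power2_eq_square power4_eq_xxxx algebra_simps)
  also have "\<dots> \<le> 3 * v\<^sup>2 + (6 * (a n)\<^sup>2 * v + (a n) ^ 4)"
    using Suc by (simp add: sgn_avg_add sgn_avg_cmult sgn_avg_const sgn_avg_power2 v_def)
  also have "\<dots> \<le> 3 * (v + (a n)\<^sup>2)\<^sup>2"
    using zero_le_power2[of "(a n)\<^sup>2"] by (simp add: power2_eq_square power4_eq_xxxx algebra_simps)
  finally show ?case by (simp add: v_def)
qed simp

text \<open>The lower bound averages the pointwise inequality
  \<open>\<sigma>\<^sup>2 s\<^sup>2 \<le> \<sigma>\<^sup>3 \<bar>s\<bar> + s\<^sup>4 / 4\<close> over the values \<open>s\<close> of the linear form.\<close>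

lemma sgn_avg_abs_ge: "sqrt (\<Sum>i<n. (a i)\<^sup>2) \<le> 4 * sgn_avg n (\<lambda>\<epsilon>. \<bar>\<Sum>i<n. \<epsilon> i * a i\<bar>)"
proof -
  define \<sigma> where "\<sigma> = sqrt (\<Sum>i<n. (a i)\<^sup>2)"
  define E where "E = sgn_avg n (\<lambda>\<epsilon>. \<bar>\<Sum>i<n. \<epsilon> i * a i\<bar>)"
  have \<sigma>: "\<sigma> \<ge> 0" "\<sigma>\<^sup>2 = (\<Sum>i<n. (a i)\<^sup>2)"
    by (simp_all add: \<sigma>_def sum_nonneg)
  have E: "E \<ge> 0"
    using sgn_avg_mono[of "\<lambda>_. 0" "\<lambda>\<epsilon>. \<bar>\<Sum>i<n. \<epsilon> i * a i\<bar>" n] by (simp add: E_def sgn_avg_const)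
  have cubic: "0 \<le> 4 - 4 * u + u ^ 3" if "u \<ge> 0" for u :: real
  proof -
    \<comment> \<open>The product is \<open>u ^ 3\<close> minus its tangent at \<open>6 / 5\<close>,
      a rational point close to the minimiser \<open>2 / sqrt 3\<close> of the cubic.\<close>
    have "0 \<le> (u - 6 / 5)\<^sup>2 * (u + 12 / 5) + (8 / 25 * u + 68 / 125)"
      using that by simp
    also have "\<dots> = 4 - 4 * u + u ^ 3"
      by (simp add: power2_eq_square power3_eq_cube field_simps)
    finally show ?thesis .
  qed
  have pointwise: "\<sigma>\<^sup>2 * s\<^sup>2 \<le> \<sigma> ^ 3 * \<bar>s\<bar> + 1 / 4 * s ^ 4" if "\<sigma> > 0" for s
  proof -
    define u where "u = \<bar>s\<bar> / \<sigma>"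
    have s: "\<bar>s\<bar> = u * \<sigma>" "u \<ge> 0" using that by (auto simp: u_def)
    have "0 \<le> \<sigma> ^ 4 * u / 4 * (4 - 4 * u + u ^ 3)"
      using cubic[OF s(2)] s(2) by simp
    also have "\<dots> = \<sigma> ^ 3 * \<bar>s\<bar> + 1 / 4 * \<bar>s\<bar> ^ 4 - \<sigma>\<^sup>2 * \<bar>s\<bar>\<^sup>2"
      unfolding s(1) by (simp add: power2_eq_square power3_eq_cube power4_eq_xxxx field_simps)
    finally show ?thesis by simp
  qed
  have "\<sigma> \<le> 4 * E"
  proof (cases "\<sigma> = 0")
    case True
    then show ?thesis using E by simp
  next
    case False
    then have pos: "\<sigma> > 0" using \<sigma> by simp
    have "\<sigma>\<^sup>2 * \<sigma>\<^sup>2 = sgn_avg n (\<lambda>\<epsilon>. \<sigma>\<^sup>2 * (\<Sum>i<n. \<epsilon> i * a i)\<^sup>2)"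
      by (simp add: sgn_avg_cmult sgn_avg_power2 \<sigma>(2))
    also have "\<dots> \<le> sgn_avg n (\<lambda>\<epsilon>. \<sigma> ^ 3 * \<bar>\<Sum>i<n. \<epsilon> i * a i\<bar> + 1 / 4 * (\<Sum>i<n. \<epsilon> i * a i) ^ 4)"
      by (rule sgn_avg_mono) (rule pointwise[OF pos])
    also have "\<dots> \<le> \<sigma> ^ 3 * E + 1 / 4 * (3 * (\<sigma>\<^sup>2)\<^sup>2)"
      unfolding sgn_avg_add sgn_avg_cmult E_def \<sigma>(2)
      by (intro add_mono mult_left_mono sgn_avg_power4) (use \<sigma>(1) in auto)
    \<comment> \<open>The fourth moment absorbs three quarters of \<open>\<sigma> ^ 4\<close>; the
      remaining quarter accounts for the factor 4.\<close>
    finally have "\<sigma> ^ 3 * \<sigma> \<le> \<sigma> ^ 3 * (4 * E)"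
      by (simp add: power2_eq_square power3_eq_cube)
    then show ?thesis using pos by (subst (asm) mult_le_cancel_left_pos) simp_all
  qed
  then show ?thesis by (simp add: \<sigma>_def E_def)
qed

text \<open>The crude \<open>\<bar>s\<bar> \<le> 1 + s^2\<close> is enough, since from above the
  weights only have to be bounded.\<close>

lemma sgn_avg_abs_le: "sgn_avg n (\<lambda>\<epsilon>. \<bar>\<Sum>i<n. \<epsilon> i * a i\<bar>) \<le> 1 + (\<Sum>i<n. (a i)\<^sup>2)"
proof -
  have "\<bar>s\<bar> \<le> 1 + s\<^sup>2" for s :: real
    using sum_power2_ge_zero[of "\<bar>s\<bar> - 1" 0] by (simp add: power2_eq_square algebra_simps)
  then have "sgn_avg n (\<lambda>\<epsilon>. \<bar>\<Sum>i<n. \<epsilon> i * a i\<bar>) \<le> sgn_avg n (\<lambda>\<epsilon>. 1 + (\<Sum>i<n. \<epsilon> i * a i)\<^sup>2)"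
    by (intro sgn_avg_mono)
  then show ?thesis by (simp add: sgn_avg_add sgn_avg_const sgn_avg_power2)
qed


section \<open>The average spread of a finite set\<close>

definition spread :: "('a \<Rightarrow> real) \<Rightarrow> 'a set \<Rightarrow> real" where
  "spread r F = Max (r ` F) - Min (r ` F)"

lemma spread_cong: "(\<And>x. x \<in> F \<Longrightarrow> r x = r' x) \<Longrightarrow> spread r F = spread r' F"
  by (simp add: spread_def cong: image_cong_simp)

lemma abs_diff_le_spread:
  assumes "finite F" "x \<in> F" "y \<in> F"
  shows "\<bar>r x - r y\<bar> \<le> spread r F"
proof -
  have "r z \<le> Max (r ` F)" "Min (r ` F) \<le> r z" if "z \<in> F" for z
    using assms(1) that by auto
  from this[OF assms(2)] this[OF assms(3)] show ?thesis
    by (simp add: spread_def)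
qed

text \<open>Maximum and minimum are attained, each at a distance from \<open>r x\<close> bounded by
  one term. Leaving out \<open>x\<close> matters once every term is replaced by
  \<open>2 * (1 + D x y)\<close>: singletons then still get weight at most 0.\<close>

lemma spread_le_sum:
  assumes F: "finite F" "x \<in> F"
  shows "spread r F \<le> (\<Sum>y\<in>F - {x}. 2 * \<bar>r x - r y\<bar>)"
proof -
  have fin: "finite (r ` F)" "r ` F \<noteq> {}" using F by auto
  obtain a where a: "a \<in> F" "Max (r ` F) = r a"
    using Max_in[OF fin] by auto
  obtain b where b: "b \<in> F" "Min (r ` F) = r b"
    using Min_in[OF fin] by auto
  have le: "\<bar>r x - r y\<bar> \<le> (\<Sum>y\<in>F - {x}. \<bar>r x - r y\<bar>)" if "y \<in> F" for y
  proof (cases "y = x")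
    case True
    then show ?thesis by (simp add: sum_nonneg)
  next
    case False
    then show ?thesis using that F by (intro member_le_sum) auto
  qed
  have "spread r F \<le> \<bar>r x - r a\<bar> + \<bar>r x - r b\<bar>"
    by (simp add: spread_def a b)
  also have "\<dots> \<le> (\<Sum>y\<in>F - {x}. 2 * \<bar>r x - r y\<bar>)"
    using le[OF a(1)] le[OF b(1)] by (simp flip: sum_distrib_left)
  finally show ?thesis .
qed

text \<open>The spread is the Lebesgue measure of the thresholds \<open>t\<close> for which \<open>F\<close> is contained neither in
  the half-space \<open>{r \<le> t}\<close> nor in its complement.\<close>

lemma spread_eq_integral:
  assumes "finite F" "F \<noteq> {}"
  shows "has_bochner_integral lborel
    (\<lambda>t. 1 - of_bool (F \<subseteq> {x. r x \<le> t}) - of_bool (F \<subseteq> {x. t < r x})) (spread r F)"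
proof -
  define a b where "a = Min (r ` F)" and "b = Max (r ` F)"
  have fin: "finite (r ` F)" "r ` F \<noteq> {}" using assms by auto
  have ab: "a \<le> b" unfolding a_def b_def using Max_in[OF fin] fin by (intro Min_le) auto
  have "F \<subseteq> {x. r x \<le> t} \<longleftrightarrow> b \<le> t" for t
    unfolding b_def Max_le_iff[OF fin] by auto
  moreover have "F \<subseteq> {x. t < r x} \<longleftrightarrow> t < a" for t
    unfolding a_def Min_gr_iff[OF fin] by auto
  ultimately have "(\<lambda>t. 1 - of_bool (F \<subseteq> {x. r x \<le> t}) - of_bool (F \<subseteq> {x. t < r x}))
      = indicat_real {a..<b}"
    using ab by (auto simp: fun_eq_iff indicator_def)
  moreover have "has_bochner_integral lborel (indicat_real {a..<b}) (measure lborel {a..<b})"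
    using ab by (intro has_bochner_integral_real_indicator) auto
  ultimately show ?thesis
    using ab by (simp add: spread_def a_def b_def)
qed

text \<open>In the integral over thresholds, the constant 1 is killed by \<open>sum c I = 0\<close>,
  while the two half-space indicators enter with a minus sign and are covered by
  \<open>pos\<close>.\<close>

lemma sum_spread_nonpos:
  assumes I: "finite I" "sum c I = 0"
    and F: "\<And>i j. \<lbrakk>i \<in> I; j \<in> I\<rbrakk> \<Longrightarrow> finite (F i j) \<and> F i j \<noteq> {}"
    and pos: "\<And>U. 0 \<le> (\<Sum>i\<in>I. \<Sum>j\<in>I. c i * c j * of_bool (F i j \<subseteq> U))"
  shows "(\<Sum>i\<in>I. \<Sum>j\<in>I. c i * c j * spread r (F i j)) \<le> (0::real)"
proof -
  define cut where "cut i j t = 1 - of_bool (F i j \<subseteq> {x. r x \<le> t}) - (of_bool (F i j \<subseteq> {x. t < r x}) :: real)"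
    for i j t
  have "has_bochner_integral lborel (\<lambda>t. \<Sum>i\<in>I. \<Sum>j\<in>I. c i * c j * cut i j t)
      (\<Sum>i\<in>I. \<Sum>j\<in>I. c i * c j * spread r (F i j))"
    unfolding cut_def using F
    by (intro has_bochner_integral_sum has_bochner_integral_mult_right spread_eq_integral) auto
  then have "(\<Sum>i\<in>I. \<Sum>j\<in>I. c i * c j * spread r (F i j))
      = (\<integral>t. (\<Sum>i\<in>I. \<Sum>j\<in>I. c i * c j * cut i j t) \<partial>lborel)"
    by (simp add: has_bochner_integral_integral_eq)
  also have "\<dots> = - (\<integral>t. - (\<Sum>i\<in>I. \<Sum>j\<in>I. c i * c j * cut i j t) \<partial>lborel)"
    unfolding Bochner_Integration.integral_minus by (rule minus_minus[symmetric])
  also have "\<dots> \<le> 0"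
    unfolding neg_le_0_iff_le
  proof (rule Bochner_Integration.integral_nonneg)
    fix t
    have "(\<Sum>i\<in>I. \<Sum>j\<in>I. c i * c j * cut i j t) =
      (\<Sum>i\<in>I. \<Sum>j\<in>I. c i * c j) - (\<Sum>i\<in>I. \<Sum>j\<in>I. c i * c j * of_bool (F i j \<subseteq> {x. r x \<le> t}))
      - (\<Sum>i\<in>I. \<Sum>j\<in>I. c i * c j * of_bool (F i j \<subseteq> {x. t < r x}))"
      unfolding cut_def sum_subtractf[symmetric] right_diff_distrib by simp
    also have "(\<Sum>i\<in>I. \<Sum>j\<in>I. c i * c j) = 0"
      using I by (simp flip: sum_product)
    finally show "0 \<le> - (\<Sum>i\<in>I. \<Sum>j\<in>I. c i * c j * cut i j t)"
      using pos[of "{x. r x \<le> t}"] pos[of "{x. t < r x}"] by linarith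
  qed
  finally show ?thesis .
qed

text \<open>\<open>W F\<close> plays the role of the measure of the set of half-spaces of the Hilbert space that
  split \<open>F\<close>; half-spaces are bounded by hyperplanes orthogonal to random sign vectors.\<close>

lemma cnd_on_splitting_weight:
  assumes D: "cnd_on X D" and X: "countable X"
  obtains W :: "'a set \<Rightarrow> real" where
    "\<And>F x y. \<lbrakk>finite F; F \<subseteq> X; x \<in> F; y \<in> F\<rbrakk> \<Longrightarrow> sqrt (D x y) \<le> 4 * W F"
    "\<And>F x. \<lbrakk>finite F; F \<subseteq> X; x \<in> F\<rbrakk> \<Longrightarrow> W F \<le> (\<Sum>y\<in>F - {x}. 2 * (1 + D x y))"
    "\<And>I c F. \<lbrakk>finite I; sum c I = 0;
        \<And>i j. \<lbrakk>i \<in> I; j \<in> I\<rbrakk> \<Longrightarrow> finite (F i j) \<and> F i j \<noteq> {} \<and> F i j \<subseteq> X;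
        \<And>U. 0 \<le> (\<Sum>i\<in>I. \<Sum>j\<in>I. c i * c j * of_bool (F i j \<subseteq> U))\<rbrakk>
        \<Longrightarrow> (\<Sum>i\<in>(I :: 'i set). \<Sum>j\<in>I. c i * c j * W (F i j)) \<le> 0"
proof -
  obtain v :: "'a \<Rightarrow> nat \<Rightarrow> real" and N :: "'a \<Rightarrow> nat" where v: "\<And>x i. \<lbrakk>x \<in> X; N x \<le> i\<rbrakk> \<Longrightarrow> v x i = 0"
    and D_eq: "\<And>x y n. \<lbrakk>x \<in> X; y \<in> X; N x \<le> n; N y \<le> n\<rbrakk> \<Longrightarrow> D x y = (\<Sum>i<n. (v x i - v y i)\<^sup>2)"
    by (rule cnd_on_countable_representation[OF D X]) blast
  \<comment> \<open>As \<open>v x\<close> vanishes from \<open>N x\<close> on, this is the whole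
    pairing of the signs with \<open>v x\<close>.\<close>
  define S where "S \<epsilon> x = (\<Sum>i<N x. \<epsilon> i * v x i)" for \<epsilon> x
  \<comment> \<open>This length covers all signs that matter on \<open>F\<close>; by
    \<open>W_eq\<close> any larger one gives the same value.\<close>
  define W where "W F = sgn_avg (Max (N ` F)) (\<lambda>\<epsilon>. spread (S \<epsilon>) F)" for F
  have S_diff: "S \<epsilon> x - S \<epsilon> y = (\<Sum>i<n. \<epsilon> i * (v x i - v y i))"
    if "x \<in> X" "y \<in> X" "N x \<le> n" "N y \<le> n" for \<epsilon> x y n
  proof -
    have "S \<epsilon> z = (\<Sum>i<n. \<epsilon> i * v z i)" if "z \<in> X" "N z \<le> n" for z
      unfolding S_def using that v[OF that(1)] by (intro sum.mono_neutral_left) auto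
    then show ?thesis using that by (simp add: right_diff_distrib sum_subtractf)
  qed
  have S_upd: "S (\<epsilon>(i := t)) x = S \<epsilon> x" if "N x \<le> i" for \<epsilon> i t x
    unfolding S_def using that by (intro sum.cong) auto
  have W_eq: "W F = sgn_avg n (\<lambda>\<epsilon>. spread (S \<epsilon>) F)" if "finite F" "F \<noteq> {}" "\<And>x. x \<in> F \<Longrightarrow> N x \<le> n" for F n
    unfolding W_def
  proof (rule sgn_avg_independent[symmetric])
    show "Max (N ` F) \<le> n" using that by simp
    show "spread (S (\<epsilon>(i := t))) F = spread (S \<epsilon>) F" if "Max (N ` F) \<le> i" for \<epsilon> i t
      using that \<open>finite F\<close> \<open>F \<noteq> {}\<close> by (intro spread_cong S_upd) simp
  qed
  have avg_diff: "sgn_avg n (\<lambda>\<epsilon>. \<bar>S \<epsilon> x - S \<epsilon> y\<bar>) = sgn_avg n (\<lambda>\<epsilon>. \<bar>\<Sum>i<n. \<epsilon> i * (v x i - v y i)\<bar>)"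
    if "x \<in> X" "y \<in> X" "N x \<le> n" "N y \<le> n" for x y n
    by (simp add: S_diff[OF that])
  show ?thesis
  proof (rule that[of W])
    fix F x y assume F: "finite F" "F \<subseteq> X" and xy: "x \<in> F" "y \<in> F"
    define n where "n = Max (N ` F)"
    have n: "N z \<le> n" if "z \<in> F" for z using that F by (simp add: n_def)
    have "sqrt (D x y) = sqrt (\<Sum>i<n. (v x i - v y i)\<^sup>2)"
      using D_eq[of x y n] F xy n by auto
    also have "\<dots> \<le> 4 * sgn_avg n (\<lambda>\<epsilon>. \<bar>\<Sum>i<n. \<epsilon> i * (v x i - v y i)\<bar>)"
      by (rule sgn_avg_abs_ge)
    also have "\<dots> = 4 * sgn_avg n (\<lambda>\<epsilon>. \<bar>S \<epsilon> x - S \<epsilon> y\<bar>)"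
      using avg_diff[of x y n] F xy n by (auto simp: subset_iff)
    also have "\<dots> \<le> 4 * W F"
      unfolding W_def n_def[symmetric]
      by (intro mult_left_mono sgn_avg_mono abs_diff_le_spread F xy) simp
    finally show "sqrt (D x y) \<le> 4 * W F" .
  next
    fix F x assume F: "finite F" "F \<subseteq> X" and x: "x \<in> F"
    define n where "n = Max (N ` F)"
    have n: "N z \<le> n" if "z \<in> F" for z using that F by (simp add: n_def)
    have "W F \<le> sgn_avg n (\<lambda>\<epsilon>. \<Sum>y\<in>F - {x}. 2 * \<bar>S \<epsilon> x - S \<epsilon> y\<bar>)"
      unfolding W_def n_def[symmetric] by (intro sgn_avg_mono spread_le_sum F x)
    also have "\<dots> = (\<Sum>y\<in>F - {x}. 2 * sgn_avg n (\<lambda>\<epsilon>. \<bar>S \<epsilon> x - S \<epsilon> y\<bar>))"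
      using F by (simp add: sgn_avg_sum sgn_avg_cmult)
    also have "\<dots> \<le> (\<Sum>y\<in>F - {x}. 2 * (1 + D x y))"
    proof (intro sum_mono mult_left_mono)
      fix y assume "y \<in> F - {x}"
      then have "x \<in> X" "y \<in> X" "N x \<le> n" "N y \<le> n" using F x n by auto
      from avg_diff[OF this] D_eq[OF this] sgn_avg_abs_le[of n "\<lambda>i. v x i - v y i"]
      show "sgn_avg n (\<lambda>\<epsilon>. \<bar>S \<epsilon> x - S \<epsilon> y\<bar>) \<le> 1 + D x y" by simp
    qed simp
    finally show "W F \<le> (\<Sum>y\<in>F - {x}. 2 * (1 + D x y))" .
  next
    fix I :: "'i set" and c :: "'i \<Rightarrow> real" and F :: "'i \<Rightarrow> 'i \<Rightarrow> 'a set"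
    assume I: "finite I" "sum c I = 0"
      and F: "\<And>i j. \<lbrakk>i \<in> I; j \<in> I\<rbrakk> \<Longrightarrow> finite (F i j) \<and> F i j \<noteq> {} \<and> F i j \<subseteq> X"
      and pos: "\<And>U. 0 \<le> (\<Sum>i\<in>I. \<Sum>j\<in>I. c i * c j * of_bool (F i j \<subseteq> U))"
    \<comment> \<open>One length for all the sets, so that the average can be pulled out of the
      double sum.\<close>
    define n where "n = Max (N ` (\<Union>i\<in>I. \<Union>j\<in>I. F i j))"
    have fin: "finite (\<Union>i\<in>I. \<Union>j\<in>I. F i j)"
      using I F by simp
    have n: "N x \<le> n" if "i \<in> I" "j \<in> I" "x \<in> F i j" for i j x
      unfolding n_def using that fin by (intro Max_ge) auto
    have "(\<Sum>i\<in>I. \<Sum>j\<in>I. c i * c j * W (F i j)) =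
        (\<Sum>i\<in>I. \<Sum>j\<in>I. c i * c j * sgn_avg n (\<lambda>\<epsilon>. spread (S \<epsilon>) (F i j)))"
      using F n by (intro sum.cong refl arg_cong2[of _ _ _ _ "(*)"] W_eq) auto
    also have "\<dots> = sgn_avg n (\<lambda>\<epsilon>. \<Sum>i\<in>I. \<Sum>j\<in>I. c i * c j * spread (S \<epsilon>) (F i j))"
      using I by (simp add: sgn_avg_sum sgn_avg_cmult)
    also have "\<dots> \<le> sgn_avg n (\<lambda>_. 0)"
      by (intro sgn_avg_mono sum_spread_nonpos I pos) (use F in auto)
    finally show "(\<Sum>i\<in>I. \<Sum>j\<in>I. c i * c j * W (F i j)) \<le> 0"
      by (simp add: sgn_avg_const)
  qed
qed


section \<open>Coarse embeddings of wreath products\<close>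

text \<open>A controlled set is covered by the graphs of finitely many right translations, and a set
  of pairs with bounded image distances lies in one sublevel set of these distances. Only these two
  kinds of sets need to be tested.\<close>

lemma coarse_embedding_iff:
  assumes "group G"
  shows "coarse_embedding G f \<longleftrightarrow>
    (\<forall>s\<in>carrier G. \<exists>C. \<forall>g\<in>carrier G. norm (f g - f (g \<otimes>\<^bsub>G\<^esub> s)) \<le> C) \<and>
    (\<forall>R. finite {inv\<^bsub>G\<^esub> g \<otimes>\<^bsub>G\<^esub> h |g h. g \<in> carrier G \<and> h \<in> carrier G \<and> norm (f g - f h) \<le> R})"
    (is "_ \<longleftrightarrow> ?bornologous \<and> ?proper")
proof -
  interpret group G by fact
  show ?thesis
  proof (intro iffI conjI)
    assume f: "coarse_embedding G f"
    show ?bornologous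
    proof
      fix s assume s: "s \<in> carrier G"
      define E where "E = (\<lambda>g. (g, g \<otimes>\<^bsub>G\<^esub> s)) ` carrier G"
      have "{inv\<^bsub>G\<^esub> g \<otimes>\<^bsub>G\<^esub> h |g h. (g, h) \<in> E} \<subseteq> {s}"
        using s by (auto simp: E_def inv_solve_left m_assoc[symmetric])
      then have "controlled G E"
        using s by (auto simp: controlled_def E_def intro: finite_subset)
      then obtain C where "\<forall>r\<in>{norm (f x - f y) |x y. (x, y) \<in> E}. r \<le> C"
        using f unfolding coarse_embedding_def controlled_def bdd_above_def by blast
      then have "norm (f g - f (g \<otimes>\<^bsub>G\<^esub> s)) \<le> C" if "g \<in> carrier G" for g
        using that by (auto simp: E_def)
      then show "\<exists>C. \<forall>g\<in>carrier G. norm (f g - f (g \<otimes>\<^bsub>G\<^esub> s)) \<le> C" by blast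
    qed
    show ?proper
    proof
      fix R
      define E where "E = {(g, h). g \<in> carrier G \<and> h \<in> carrier G \<and> norm (f g - f h) \<le> R}"
      have "bdd_above {norm (f x - f y) |x y. (x, y) \<in> E}"
        by (rule bdd_aboveI[of _ R]) (auto simp: E_def)
      moreover have "E \<subseteq> carrier G \<times> carrier G" by (auto simp: E_def)
      ultimately have "controlled G E" using f unfolding coarse_embedding_def by blast
      then show "finite {inv\<^bsub>G\<^esub> g \<otimes>\<^bsub>G\<^esub> h |g h. g \<in> carrier G \<and> h \<in> carrier G \<and> norm (f g - f h) \<le> R}"
        by (simp add: controlled_def E_def)
    qed
  next
    assume *: "?bornologous \<and> ?proper"
    then obtain C where C: "\<And>s g. \<lbrakk>s \<in> carrier G; g \<in> carrier G\<rbrakk> \<Longrightarrow> norm (f g - f (g \<otimes>\<^bsub>G\<^esub> s)) \<le> C s"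
      by metis
    show "coarse_embedding G f"
      unfolding coarse_embedding_def
    proof (intro allI impI iffI)
      fix E assume E: "E \<subseteq> carrier G \<times> carrier G" and "controlled G E"
      define S where "S = {inv\<^bsub>G\<^esub> g \<otimes>\<^bsub>G\<^esub> h |g h. (g, h) \<in> E}"
      have S: "finite S" using \<open>controlled G E\<close> by (simp add: controlled_def S_def)
      have "norm (f x - f y) \<le> Max (C ` S)" if "(x, y) \<in> E" for x y
      proof -
        have xy: "x \<in> carrier G" "y \<in> carrier G" using E that by auto
        then have "y = x \<otimes>\<^bsub>G\<^esub> (inv\<^bsub>G\<^esub> x \<otimes>\<^bsub>G\<^esub> y)" by (simp add: m_assoc[symmetric])
        then have "norm (f x - f y) \<le> C (inv\<^bsub>G\<^esub> x \<otimes>\<^bsub>G\<^esub> y)"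
          using C[of "inv\<^bsub>G\<^esub> x \<otimes>\<^bsub>G\<^esub> y" x] xy by simp
        also have "\<dots> \<le> Max (C ` S)"
          using S that by (intro Max_ge) (auto simp: S_def)
        finally show ?thesis .
      qed
      then show "bdd_above {norm (f x - f y) |x y. (x, y) \<in> E}"
        by (intro bdd_aboveI[of _ "Max (C ` S)"]) auto
    next
      fix E assume E: "E \<subseteq> carrier G \<times> carrier G"
        and "bdd_above {norm (f x - f y) |x y. (x, y) \<in> E}"
      then obtain R where R: "\<forall>r\<in>{norm (f x - f y) |x y. (x, y) \<in> E}. r \<le> R"
        unfolding bdd_above_def by blast
      have "{inv\<^bsub>G\<^esub> g \<otimes>\<^bsub>G\<^esub> h |g h. (g, h) \<in> E} \<subseteq>
          {inv\<^bsub>G\<^esub> g \<otimes>\<^bsub>G\<^esub> h |g h. g \<in> carrier G \<and> h \<in> carrier G \<and> norm (f g - f h) \<le> R}"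
        using E R by blast
      then show "controlled G E"
        using * E unfolding controlled_def by (blast intro: finite_subset)
    qed
  qed
qed

text \<open>An element is determined by its graph over its support, a finite subset of a countable
  set.\<close>

lemma countable_carrier_sum_group:
  assumes "group H" "countable I" "countable (carrier H)"
  shows "countable (carrier (sum_group I (\<lambda>_. H)))"
proof (rule countableI')
  define graph where "graph \<phi> = (\<lambda>x. (x, \<phi> x)) ` {x \<in> I. \<phi> x \<noteq> \<one>\<^bsub>H\<^esub>}" for \<phi>
  let ?N = "carrier (sum_group I (\<lambda>_. H))"
  let ?P = "{P. P \<subseteq> I \<times> carrier H \<and> finite P}"
  have graph: "graph ` ?N \<subseteq> ?P"
    using assms(1) by (auto simp: graph_def carrier_sum_group)
  have inj: "inj_on graph ?N"
  proof (rule inj_onI)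
    fix \<phi> \<psi> assume N: "\<phi> \<in> ?N" "\<psi> \<in> ?N" and eq: "graph \<phi> = graph \<psi>"
    have mem: "(x, b) \<in> graph \<theta> \<longleftrightarrow> x \<in> I \<and> b = \<theta> x \<and> b \<noteq> \<one>\<^bsub>H\<^esub>" for x b \<theta>
      by (auto simp: graph_def)
    have "\<phi> x = \<psi> x" if "x \<in> I" for x
      using mem[of x "\<phi> x" \<phi>] mem[of x "\<phi> x" \<psi>] mem[of x "\<psi> x" \<phi>] mem[of x "\<psi> x" \<psi>] eq that by metis
    then show "\<phi> = \<psi>" using N assms(1) by (auto simp: carrier_sum_group intro: PiE_ext)
  qed
  have "countable ?P"
    using countable_Collect_finite_subset[of "I \<times> carrier H"] assms by (simp add: conj_commute)
  then have "inj_on (to_nat_on ?P \<circ> graph) ?N"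
    using inj graph by (intro comp_inj_on) (auto intro: inj_on_subset[OF inj_on_to_nat_on])
  then show "inj_on (to_nat_on ?P \<circ> graph) ?N" .
qed

section \<open>Kernels on the wreath product\<close>

text \<open>Grouping the indices by their value under \<open>\<theta>\<close> gives a sum of
  squares, one for each value.\<close>

lemma sum_equal_values_nonneg:
  fixes b :: "'i \<Rightarrow> real"
  assumes "finite I"
  shows "0 \<le> (\<Sum>i\<in>I. \<Sum>j\<in>I. b i * b j * of_bool (\<theta> i = \<theta> j))"
proof -
  have "(\<Sum>i\<in>I. \<Sum>j\<in>I. b i * b j * of_bool (\<theta> i = \<theta> j)) =
      (\<Sum>i\<in>I. \<Sum>j\<in>I. \<Sum>v\<in>\<theta> ` I. (b i * of_bool (\<theta> i = v)) * (b j * of_bool (\<theta> j = v)))"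
  proof (intro sum.cong refl)
    fix i j assume "i \<in> I" "j \<in> I"
    have "(\<Sum>v\<in>\<theta> ` I. (b i * of_bool (\<theta> i = v)) * (b j * of_bool (\<theta> j = v)))
        = (\<Sum>v\<in>\<theta> ` I. if v = \<theta> i then b i * b j * of_bool (\<theta> j = \<theta> i) else 0)"
      by (intro sum.cong) auto
    then show "b i * b j * of_bool (\<theta> i = \<theta> j) =
        (\<Sum>v\<in>\<theta> ` I. (b i * of_bool (\<theta> i = v)) * (b j * of_bool (\<theta> j = v)))"
      using assms \<open>i \<in> I\<close> by (auto simp: of_bool_def)
  qed
  also have "\<dots> = (\<Sum>v\<in>\<theta> ` I. (\<Sum>i\<in>I. b i * of_bool (\<theta> i = v)) * (\<Sum>j\<in>I. b j * of_bool (\<theta> j = v)))"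
    unfolding sum_product by (subst sum.swap[of _ "\<theta> ` I"]) (intro sum.cong refl sum.swap)
  also have "\<dots> \<ge> 0" by (intro sum_nonneg) simp
  finally show ?thesis .
qed

text \<open>For a set \<open>U\<close>, the condition that \<open>U\<close> contain \<open>g\<close>, \<open>h\<close> and the points where \<open>\<phi>\<close> and \<open>\<psi>\<close> differ
  says that \<open>g, h \<in> U\<close> and that \<open>\<phi>\<close> and \<open>\<psi>\<close> have the same restriction to the complement of \<open>U\<close>,
  which makes it a positive semidefinite kernel.\<close>

lemma cnd_on_splitting_wreath:
  fixes X :: "'a set" and Y :: "(('a \<Rightarrow> 'h) \<times> 'a) set"
  defines "T \<equiv> \<lambda>x y. {snd x, snd y} \<union> {z \<in> X. fst x z \<noteq> fst y z}"
  assumes W: "\<And>x. x \<in> X \<Longrightarrow> W {x} = 0"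
    and cuts: "\<And>I c F. \<lbrakk>finite I; sum c I = 0;
        \<And>i j. \<lbrakk>i \<in> I; j \<in> I\<rbrakk> \<Longrightarrow> finite (F i j) \<and> F i j \<noteq> {} \<and> F i j \<subseteq> X;
        \<And>U. 0 \<le> (\<Sum>i\<in>I. \<Sum>j\<in>I. c i * c j * of_bool (F i j \<subseteq> U))\<rbrakk>
        \<Longrightarrow> (\<Sum>i\<in>(I :: (('a \<Rightarrow> 'h) \<times> 'a) set). \<Sum>j\<in>I. c i * c j * (W (F i j) :: real)) \<le> 0"
    and Y: "\<And>x. x \<in> Y \<Longrightarrow> snd x \<in> X"
    and fin: "\<And>x y. \<lbrakk>x \<in> Y; y \<in> Y\<rbrakk> \<Longrightarrow> finite {z \<in> X. fst x z \<noteq> fst y z}"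
  shows "cnd_on Y (\<lambda>x y. W (T x y))"
  unfolding cnd_on_def
proof (intro conjI ballI allI impI)
  show "W (T x x) = 0" if "x \<in> Y" for x
    using W Y[OF that] by (simp add: T_def)
  show "W (T x y) = W (T y x)" for x y
    by (rule arg_cong[of _ _ W]) (auto simp: T_def)
next
  fix A :: "(('a \<Rightarrow> 'h) \<times> 'a) set" and c :: "('a \<Rightarrow> 'h) \<times> 'a \<Rightarrow> real"
  assume A: "finite A" "A \<subseteq> Y" "sum c A = 0"
  show "(\<Sum>x\<in>A. \<Sum>y\<in>A. c x * c y * W (T x y)) \<le> 0"
  proof (rule cuts)
    show "finite (T x y) \<and> T x y \<noteq> {} \<and> T x y \<subseteq> X" if "x \<in> A" "y \<in> A" for x y
      using A(2) that Y[of x] Y[of y] fin[of x y] unfolding T_def by auto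
    fix U
    have "x \<in> A \<Longrightarrow> y \<in> A \<Longrightarrow> T x y \<subseteq> U \<longleftrightarrow>
        snd x \<in> U \<and> snd y \<in> U \<and> restrict (fst x) (X - U) = restrict (fst y) (X - U)" for x y
      by (auto simp: T_def restrict_def fun_eq_iff)
    then have "(\<Sum>x\<in>A. \<Sum>y\<in>A. c x * c y * of_bool (T x y \<subseteq> U)) =
        (\<Sum>x\<in>A. \<Sum>y\<in>A. (c x * of_bool (snd x \<in> U)) * (c y * of_bool (snd y \<in> U)) *
          of_bool (restrict (fst x) (X - U) = restrict (fst y) (X - U)))"
      by (intro sum.cong refl) auto
    also have "\<dots> \<ge> 0" by (rule sum_equal_values_nonneg) fact
    finally show "0 \<le> (\<Sum>x\<in>A. \<Sum>y\<in>A. c x * c y * of_bool (T x y \<subseteq> U))" .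
  qed (use A in auto)
qed

text \<open>Terms with equal values are zero, so for finitely many points all pairs may be summed
  over one finite set \<open>Z\<close>. Each \<open>z\<close> then contributes the pullback of a
  squared distance.\<close>

lemma cnd_on_sum_norm_diff:
  fixes k :: "'h \<Rightarrow> 'v :: real_inner" and p :: "'y \<Rightarrow> 'a \<Rightarrow> 'h"
  assumes fin: "\<And>x y. \<lbrakk>x \<in> Y; y \<in> Y\<rbrakk> \<Longrightarrow> finite {z \<in> X. p x z \<noteq> p y z}"
  shows "cnd_on Y (\<lambda>x y. \<Sum>z | z \<in> X \<and> p x z \<noteq> p y z. (norm (k (p x z) - k (p y z)))\<^sup>2)"
  unfolding cnd_on_def
proof (intro conjI ballI allI impI)
  show "(\<Sum>z | z \<in> X \<and> p x z \<noteq> p y z. (norm (k (p x z) - k (p y z)))\<^sup>2) =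
      (\<Sum>z | z \<in> X \<and> p y z \<noteq> p x z. (norm (k (p y z) - k (p x z)))\<^sup>2)" for x y
    by (intro sum.cong) (auto simp: norm_minus_commute)
next
  fix A :: "'y set" and c :: "'y \<Rightarrow> real"
  assume A: "finite A" "A \<subseteq> Y" "sum c A = 0"
  define Z where "Z = (\<Union>x\<in>A. \<Union>y\<in>A. {z \<in> X. p x z \<noteq> p y z})"
  have Z: "finite Z" unfolding Z_def using A fin by (intro finite_UN_I) auto
  have "(\<Sum>x\<in>A. \<Sum>y\<in>A. c x * c y * (\<Sum>z | z \<in> X \<and> p x z \<noteq> p y z. (norm (k (p x z) - k (p y z)))\<^sup>2)) =
      (\<Sum>x\<in>A. \<Sum>y\<in>A. \<Sum>z\<in>Z. c x * c y * (norm (k (p x z) - k (p y z)))\<^sup>2)"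
    unfolding sum_distrib_left[symmetric]
    by (intro sum.cong refl arg_cong2[of _ _ _ _ "(*)"] sum.mono_neutral_left Z) (auto simp: Z_def)
  also have "\<dots> = (\<Sum>z\<in>Z. \<Sum>x\<in>A. \<Sum>y\<in>A. c x * c y * (norm (k (p x z) - k (p y z)))\<^sup>2)"
    by (subst sum.swap[of _ Z]) (intro sum.cong refl sum.swap)
  also have "\<dots> \<le> 0"
    by (intro sum_nonpos cnd_onD(3)[OF cnd_on_norm_diff[of UNIV "\<lambda>x. k (p x z)" for z]]) (use A in auto)
  finally show "(\<Sum>x\<in>A. \<Sum>y\<in>A. c x * c y *
      (\<Sum>z | z \<in> X \<and> p x z \<noteq> p y z. (norm (k (p x z) - k (p y z)))\<^sup>2)) \<le> 0" .
qed simp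

lemma mem_carrier_wreath_product:
  assumes "group H"
  shows "(\<phi>, g) \<in> carrier (wreath_product H G) \<longleftrightarrow>
    \<phi> \<in> carrier G \<rightarrow>\<^sub>E carrier H \<and> finite {z \<in> carrier G. \<phi> z \<noteq> \<one>\<^bsub>H\<^esub>} \<and> g \<in> carrier G"
  using assms by (auto simp: wreath_product_def semidirect_product_def carrier_sum_group)

text \<open>For the left coarse structure right multiplication counts: it alters
  \<open>\<phi>\<close> only on the translate by \<open>g\<close> of the support of
  \<open>\<eta>\<close>.\<close>

lemma mult_wreath_product:
  assumes "group G" "g \<in> carrier G"
  shows "(\<phi>, g) \<otimes>\<^bsub>wreath_product H G\<^esub> (\<eta>, s) =
    (\<lambda>z\<in>carrier G. \<phi> z \<otimes>\<^bsub>H\<^esub> \<eta> (inv\<^bsub>G\<^esub> g \<otimes>\<^bsub>G\<^esub> z), g \<otimes>\<^bsub>G\<^esub> s)"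
  using assms by (auto simp: wreath_product_def semidirect_product_def shift_def restrict_def fun_eq_iff)

theorem theorem1p4:
  fixes G :: "('g, 'm) monoid_scheme" and H :: "('h, 'n) monoid_scheme"
    and f :: "'g \<Rightarrow> 'u :: {real_inner, complete_space}"
    and k :: "'h \<Rightarrow> 'v :: {real_inner, complete_space}"
  assumes "group G" and "countable (carrier G)"
    and "group H" and "countable (carrier H)"
    and "coarse_embedding G f"
    and "coarse_embedding H k"
  shows "\<exists>F :: ('g \<Rightarrow> 'h) \<times> 'g \<Rightarrow> nat ell2. coarse_embedding (wreath_product H G) F"
proof -
  interpret G: group G by fact
  interpret H: group H by fact
  define \<Gamma> where "\<Gamma> = wreath_product H G"
  interpret \<Gamma>: group \<Gamma> unfolding \<Gamma>_def by (rule group_wreath_product) fact+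
  obtain C where C: "\<And>s g. \<lbrakk>s \<in> carrier G; g \<in> carrier G\<rbrakk> \<Longrightarrow> norm (f g - f (g \<otimes>\<^bsub>G\<^esub> s)) \<le> C s"
    using assms(5) unfolding coarse_embedding_iff[OF assms(1)] by metis
  obtain C' where C': "\<And>s g. \<lbrakk>s \<in> carrier H; g \<in> carrier H\<rbrakk> \<Longrightarrow> norm (k g - k (g \<otimes>\<^bsub>H\<^esub> s)) \<le> C' s"
    using assms(6) unfolding coarse_embedding_iff[OF assms(3)] by metis
  have countable: "countable (carrier \<Gamma>)"
    using countable_carrier_sum_group[OF assms(3,2,4)] assms(2)
    by (simp add: \<Gamma>_def wreath_product_def semidirect_product_def del: carrier_sum_group)
  note mem = mem_carrier_wreath_product[where G = G, OF assms(3), folded \<Gamma>_def]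
  note mult = mult_wreath_product[where H = H, OF assms(1), folded \<Gamma>_def]
  have fin: "finite {z \<in> carrier G. fst x z \<noteq> fst y z}" if "x \<in> carrier \<Gamma>" "y \<in> carrier \<Gamma>" for x y
  proof (rule finite_subset)
    show "{z \<in> carrier G. fst x z \<noteq> fst y z} \<subseteq>
        {z \<in> carrier G. fst x z \<noteq> \<one>\<^bsub>H\<^esub>} \<union> {z \<in> carrier G. fst y z \<noteq> \<one>\<^bsub>H\<^esub>}"
      by auto
    show "finite ({z \<in> carrier G. fst x z \<noteq> \<one>\<^bsub>H\<^esub>} \<union> {z \<in> carrier G. fst y z \<noteq> \<one>\<^bsub>H\<^esub>})"
      using that mem[of "fst x" "snd x"] mem[of "fst y" "snd y"] by simp
  qed
  have snd: "snd x \<in> carrier G" if "x \<in> carrier \<Gamma>" for x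
    using that mem[of "fst x" "snd x"] by simp

  obtain W :: "'g set \<Rightarrow> real" where
    W_ge: "\<And>F x y. \<lbrakk>finite F; F \<subseteq> carrier G; x \<in> F; y \<in> F\<rbrakk> \<Longrightarrow> sqrt ((norm (f x - f y))\<^sup>2) \<le> 4 * W F"
    and W_le: "\<And>F x. \<lbrakk>finite F; F \<subseteq> carrier G; x \<in> F\<rbrakk>
      \<Longrightarrow> W F \<le> (\<Sum>y\<in>F - {x}. 2 * (1 + (norm (f x - f y))\<^sup>2))"
    and cuts: "\<And>I c F. \<lbrakk>finite I; sum c I = 0;
        \<And>i j. \<lbrakk>i \<in> I; j \<in> I\<rbrakk> \<Longrightarrow> finite (F i j) \<and> F i j \<noteq> {} \<and> F i j \<subseteq> carrier G;
        \<And>U. 0 \<le> (\<Sum>i\<in>I. \<Sum>j\<in>I. c i * c j * of_bool (F i j \<subseteq> U))\<rbrakk>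
        \<Longrightarrow> (\<Sum>i\<in>(I :: (('g \<Rightarrow> 'h) \<times> 'g) set). \<Sum>j\<in>I. c i * c j * W (F i j)) \<le> 0"
    by (rule cnd_on_splitting_weight[OF cnd_on_norm_diff[of "carrier G" f] assms(2)]) blast
  \<comment> \<open>The lower bound with equal points gives \<open>W {x} \<ge> 0\<close>; the upper
    bound is an empty sum.\<close>
  have W0: "W {x} = 0" if "x \<in> carrier G" for x
    using W_ge[of "{x}" x x] W_le[of "{x}" x] that by simp

  define T where "T x y = {snd x, snd y} \<union> {z \<in> carrier G. fst x z \<noteq> fst y z}"
    for x y :: "('g \<Rightarrow> 'h) \<times> 'g"
  have T: "finite (T x y)" "T x y \<subseteq> carrier G" if "x \<in> carrier \<Gamma>" "y \<in> carrier \<Gamma>" for x y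
    using that fin snd by (auto simp: T_def)
  define D where "D x y = W (T x y) +
      (\<Sum>z | z \<in> carrier G \<and> fst x z \<noteq> fst y z. (norm (k (fst x z) - k (fst y z)))\<^sup>2)" for x y
  have "cnd_on (carrier \<Gamma>) D"
    unfolding D_def T_def
    by (intro cnd_on_add cnd_on_splitting_wreath cnd_on_sum_norm_diff W0 cuts fin snd)
  then obtain F :: "('g \<Rightarrow> 'h) \<times> 'g \<Rightarrow> nat ell2"
    where F: "\<And>x y. \<lbrakk>x \<in> carrier \<Gamma>; y \<in> carrier \<Gamma>\<rbrakk> \<Longrightarrow> (norm (F x - F y))\<^sup>2 = D x y"
    using cnd_on_ell2_representation[OF _ countable] by blast

  have bornologous: "\<exists>B. \<forall>x\<in>carrier \<Gamma>. norm (F x - F (x \<otimes>\<^bsub>\<Gamma>\<^esub> s)) \<le> B" if s: "s \<in> carrier \<Gamma>" for s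
  proof -
    obtain \<eta> t where s_eq: "s = (\<eta>, t)" by (cases s)
    define P where "P = {w \<in> carrier G. \<eta> w \<noteq> \<one>\<^bsub>H\<^esub>}"
    \<comment> \<open>The translate of \<open>Q\<close> by \<open>g\<close> contains
      \<open>T x y\<close>: the unit and \<open>t\<close> account for the two group coordinates,
      \<open>P\<close> for the places where the functions differ.\<close>
    define Q where "Q = insert \<one>\<^bsub>G\<^esub> (insert t P)"
    have \<eta>: "\<And>w. w \<in> carrier G \<Longrightarrow> \<eta> w \<in> carrier H" and P: "finite P" and t: "t \<in> carrier G"
      using s mem by (auto simp: s_eq P_def)
    have Q: "finite Q" "Q \<subseteq> carrier G" "P \<subseteq> carrier G" using P t by (auto simp: Q_def P_def)
    \<comment> \<open>Independent of \<open>x\<close>, since \<open>C\<close> and \<open>C'\<close>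
      bound displacements under right translation uniformly in the base point.\<close>
    define B where "B = (\<Sum>w\<in>Q. 2 * (1 + (C w)\<^sup>2)) + (\<Sum>w\<in>P. (C' (\<eta> w))\<^sup>2)"
    have "norm (F x - F (x \<otimes>\<^bsub>\<Gamma>\<^esub> s)) \<le> sqrt B" if x: "x \<in> carrier \<Gamma>" for x
    proof -
      obtain \<phi> g where x_eq: "x = (\<phi>, g)" by (cases x)
      have \<phi>: "\<And>z. z \<in> carrier G \<Longrightarrow> \<phi> z \<in> carrier H" and g: "g \<in> carrier G"
        using x mem by (auto simp: x_eq)
      define y where "y = x \<otimes>\<^bsub>\<Gamma>\<^esub> s"
      have y: "y \<in> carrier \<Gamma>" using x s by (simp add: y_def)
      have y_eq: "y = (\<lambda>z\<in>carrier G. \<phi> z \<otimes>\<^bsub>H\<^esub> \<eta> (inv\<^bsub>G\<^esub> g \<otimes>\<^bsub>G\<^esub> z), g \<otimes>\<^bsub>G\<^esub> t)"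
        by (simp add: y_def x_eq s_eq mult g)
      define tr where "tr w = g \<otimes>\<^bsub>G\<^esub> w" for w
      have tr_inv: "z = tr (inv\<^bsub>G\<^esub> g \<otimes>\<^bsub>G\<^esub> z)" if "z \<in> carrier G" for z
        using that g by (simp add: tr_def G.m_assoc[symmetric])
      have inv_tr: "inv\<^bsub>G\<^esub> g \<otimes>\<^bsub>G\<^esub> tr w = w" if "w \<in> carrier G" for w
        using that g by (simp add: tr_def G.m_assoc[symmetric])
      have inj: "inj_on tr A" if "A \<subseteq> carrier G" for A
        using inv_tr that by (metis inj_onI subsetD)
      have diff: "{z \<in> carrier G. fst x z \<noteq> fst y z} \<subseteq> tr ` P"
      proof
        fix z assume z: "z \<in> {z \<in> carrier G. fst x z \<noteq> fst y z}"
        then have "\<eta> (inv\<^bsub>G\<^esub> g \<otimes>\<^bsub>G\<^esub> z) \<noteq> \<one>\<^bsub>H\<^esub>"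
          using \<phi> by (auto simp: x_eq y_eq)
        then have "inv\<^bsub>G\<^esub> g \<otimes>\<^bsub>G\<^esub> z \<in> P" using z g by (simp add: P_def)
        then show "z \<in> tr ` P" using tr_inv z by blast
      qed
      have "g = tr \<one>\<^bsub>G\<^esub>" "g \<otimes>\<^bsub>G\<^esub> t = tr t" using g by (simp_all add: tr_def)
      then have T_sub: "T x y \<subseteq> tr ` Q"
        using diff by (auto simp: T_def Q_def x_eq y_eq)
      have "W (T x y) \<le> (\<Sum>z\<in>T x y - {g}. 2 * (1 + (norm (f g - f z))\<^sup>2))"
        by (intro W_le T x y) (simp add: T_def x_eq)
      also have "\<dots> \<le> (\<Sum>z\<in>tr ` Q. 2 * (1 + (norm (f g - f z))\<^sup>2))"
        using T_sub Q by (intro sum_mono2) auto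
      also have "\<dots> = (\<Sum>w\<in>Q. 2 * (1 + (norm (f g - f (g \<otimes>\<^bsub>G\<^esub> w)))\<^sup>2))"
        using sum.reindex[OF inj[OF Q(2)]] by (simp add: tr_def)
      also have "\<dots> \<le> (\<Sum>w\<in>Q. 2 * (1 + (C w)\<^sup>2))"
        using Q C g by (intro sum_mono mult_left_mono add_left_mono power_mono) auto
      finally have W_bound: "W (T x y) \<le> (\<Sum>w\<in>Q. 2 * (1 + (C w)\<^sup>2))" .
      have "(\<Sum>z | z \<in> carrier G \<and> fst x z \<noteq> fst y z. (norm (k (fst x z) - k (fst y z)))\<^sup>2) \<le>
          (\<Sum>z\<in>tr ` P. (norm (k (fst x z) - k (fst y z)))\<^sup>2)"
        using diff P by (intro sum_mono2) auto
      also have "\<dots> = (\<Sum>w\<in>P. (norm (k (fst x (tr w)) - k (fst y (tr w))))\<^sup>2)"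
        using sum.reindex[OF inj[OF Q(3)]] by simp
      also have "\<dots> \<le> (\<Sum>w\<in>P. (C' (\<eta> w))\<^sup>2)"
      proof (intro sum_mono power_mono)
        fix w assume "w \<in> P"
        then have w: "w \<in> carrier G" "tr w \<in> carrier G" using Q g by (auto simp: tr_def)
        then show "norm (k (fst x (tr w)) - k (fst y (tr w))) \<le> C' (\<eta> w)"
          using C'[OF \<eta>[OF w(1)] \<phi>[OF w(2)]] by (simp add: x_eq y_eq inv_tr)
      qed simp
      finally have "(norm (F x - F y))\<^sup>2 \<le> B"
        using W_bound unfolding F[OF x y] D_def B_def by linarith
      then show ?thesis by (simp add: y_def real_le_rsqrt)
    qed
    then show ?thesis by blast
  qed

  have proper: "finite {inv\<^bsub>\<Gamma>\<^esub> x \<otimes>\<^bsub>\<Gamma>\<^esub> y |x y. x \<in> carrier \<Gamma> \<and> y \<in> carrier \<Gamma> \<and> norm (F x - F y) \<le> R}" for R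
  proof -
    \<comment> \<open>The radius comes from
      \<open>4 * W (T x y) \<le> 4 * D x y \<le> 4 * R^2\<close>, which bounds the
      \<open>f\<close>-distance from \<open>snd x\<close> to the points of
      \<open>T x y\<close>.\<close>
    define K where "K = {inv\<^bsub>G\<^esub> g \<otimes>\<^bsub>G\<^esub> h |g h. g \<in> carrier G \<and> h \<in> carrier G \<and> norm (f g - f h) \<le> 4 * R\<^sup>2}"
    define L where "L = {inv\<^bsub>H\<^esub> a \<otimes>\<^bsub>H\<^esub> b |a b. a \<in> carrier H \<and> b \<in> carrier H \<and> norm (k a - k b) \<le> R}"
    \<comment> \<open>Rebuilds \<open>\<eta>\<close> from its restriction to \<open>K\<close>: the
      value is the unit on the rest of \<open>carrier G\<close> and \<open>undefined\<close>
      outside, because elements of the direct sum are extensional.\<close>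
    define ext where "ext \<eta> = (\<lambda>w\<in>carrier G. if w \<in> K then \<eta> w else \<one>\<^bsub>H\<^esub>)" for \<eta>
    have K: "finite K" unfolding K_def using assms(5) coarse_embedding_iff[OF assms(1)] by blast
    have L: "finite L" unfolding L_def using assms(6) coarse_embedding_iff[OF assms(3)] by blast
    have "finite ((ext ` (K \<rightarrow>\<^sub>E L)) \<times> K)"
      using K L by (intro finite_cartesian_product finite_imageI finite_PiE) auto
    moreover have "inv\<^bsub>\<Gamma>\<^esub> x \<otimes>\<^bsub>\<Gamma>\<^esub> y \<in> (ext ` (K \<rightarrow>\<^sub>E L)) \<times> K"
      if x: "x \<in> carrier \<Gamma>" and y: "y \<in> carrier \<Gamma>" and R: "norm (F x - F y) \<le> R" for x y
    proof -
      define s where "s = inv\<^bsub>\<Gamma>\<^esub> x \<otimes>\<^bsub>\<Gamma>\<^esub> y"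
      have s: "s \<in> carrier \<Gamma>" and xs: "y = x \<otimes>\<^bsub>\<Gamma>\<^esub> s"
        using x y by (simp_all add: s_def \<Gamma>.m_assoc[symmetric])
      obtain \<phi> g where x_eq: "x = (\<phi>, g)" by (cases x)
      obtain \<eta> t where s_eq: "s = (\<eta>, t)" by (cases s)
      have \<phi>: "\<And>z. z \<in> carrier G \<Longrightarrow> \<phi> z \<in> carrier H" and g: "g \<in> carrier G"
        using x mem by (auto simp: x_eq)
      have \<eta>: "\<eta> \<in> carrier G \<rightarrow>\<^sub>E carrier H" and t: "t \<in> carrier G"
        using s mem by (auto simp: s_eq)
      have y_eq: "y = (\<lambda>z\<in>carrier G. \<phi> z \<otimes>\<^bsub>H\<^esub> \<eta> (inv\<^bsub>G\<^esub> g \<otimes>\<^bsub>G\<^esub> z), g \<otimes>\<^bsub>G\<^esub> t)"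
        by (simp add: xs x_eq s_eq mult g)
      have R0: "R \<ge> 0" using R norm_ge_zero order_trans by blast
      have D: "D x y \<le> R\<^sup>2" using F[OF x y] R by (metis norm_ge_zero power_mono)
      have W_nonneg: "0 \<le> W (T x y)"
        using W_ge[OF T[OF x y], of g g] by (simp add: T_def x_eq)
      have sum_nn: "0 \<le> (\<Sum>z | z \<in> carrier G \<and> fst x z \<noteq> fst y z. (norm (k (fst x z) - k (fst y z)))\<^sup>2)"
        by (intro sum_nonneg) simp
      have f_close: "norm (f g - f z) \<le> 4 * R\<^sup>2" if "z \<in> T x y" for z
        using W_ge[OF T[OF x y] _ that, of g] D sum_nn by (simp add: T_def x_eq D_def)
      have k_close: "norm (k (fst x z) - k (fst y z)) \<le> R" if "z \<in> carrier G" for z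
      proof (cases "fst x z = fst y z")
        case True
        then show ?thesis using R0 by simp
      next
        case False
        then have "(norm (k (fst x z) - k (fst y z)))\<^sup>2 \<le>
            (\<Sum>z | z \<in> carrier G \<and> fst x z \<noteq> fst y z. (norm (k (fst x z) - k (fst y z)))\<^sup>2)"
          using fin[OF x y] that by (intro member_le_sum) auto
        also have "\<dots> \<le> R\<^sup>2" using D W_nonneg by (simp add: D_def)
        finally show ?thesis using R0 by (rule power2_le_imp_le)
      qed
      have in_K: "w \<in> K" if "g \<otimes>\<^bsub>G\<^esub> w \<in> T x y" "w \<in> carrier G" for w
      proof -
        have "w = inv\<^bsub>G\<^esub> g \<otimes>\<^bsub>G\<^esub> (g \<otimes>\<^bsub>G\<^esub> w)" using that g by (simp add: G.m_assoc[symmetric])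
        then show ?thesis unfolding K_def using f_close[OF that(1)] g that(2) by blast
      qed
      have tK: "t \<in> K" by (rule in_K) (simp_all add: T_def y_eq t)
      have xy_at: "fst x (g \<otimes>\<^bsub>G\<^esub> w) = \<phi> (g \<otimes>\<^bsub>G\<^esub> w)"
        "fst y (g \<otimes>\<^bsub>G\<^esub> w) = \<phi> (g \<otimes>\<^bsub>G\<^esub> w) \<otimes>\<^bsub>H\<^esub> \<eta> w" if "w \<in> carrier G" for w
        using that g by (simp_all add: x_eq y_eq G.m_assoc[symmetric])
      \<comment> \<open>Otherwise \<open>x\<close> and \<open>y\<close> differ at the translate of
        \<open>w\<close> by \<open>g\<close>, which puts that point into \<open>T x y\<close> and
        hence \<open>w\<close> into \<open>K\<close>.\<close>
      have \<eta>_eq_one: "\<eta> w = \<one>\<^bsub>H\<^esub>" if "w \<in> carrier G" "w \<notin> K" for w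
      proof -
        have "fst x (g \<otimes>\<^bsub>G\<^esub> w) = fst y (g \<otimes>\<^bsub>G\<^esub> w)"
          using in_K[of w] that g unfolding T_def by blast
        then have "\<phi> (g \<otimes>\<^bsub>G\<^esub> w) = \<phi> (g \<otimes>\<^bsub>G\<^esub> w) \<otimes>\<^bsub>H\<^esub> \<eta> w"
          unfolding xy_at[OF that(1)] .
        moreover have "\<phi> (g \<otimes>\<^bsub>G\<^esub> w) \<in> carrier H" "\<eta> w \<in> carrier H"
          using \<phi> \<eta> g that by auto
        ultimately show ?thesis by (simp only: H.l_cancel_one')
      qed
      have \<eta>_in: "\<eta> w \<in> L" if "w \<in> carrier G" for w
      proof -
        let ?a = "\<phi> (g \<otimes>\<^bsub>G\<^esub> w)"
        have a: "?a \<in> carrier H" "\<eta> w \<in> carrier H" using \<phi> \<eta> g that by auto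
        then have "\<eta> w = inv\<^bsub>H\<^esub> ?a \<otimes>\<^bsub>H\<^esub> (?a \<otimes>\<^bsub>H\<^esub> \<eta> w)" by (simp add: H.m_assoc[symmetric])
        moreover have "norm (k ?a - k (?a \<otimes>\<^bsub>H\<^esub> \<eta> w)) \<le> R"
          using k_close[of "g \<otimes>\<^bsub>G\<^esub> w"] xy_at[OF that] g that by simp
        ultimately show ?thesis unfolding L_def using a H.m_closed by blast
      qed
      have KG: "K \<subseteq> carrier G" by (auto simp: K_def)
      have "\<eta> = ext (restrict \<eta> K)"
        using \<eta> \<eta>_eq_one by (auto simp: ext_def fun_eq_iff restrict_def PiE_def extensional_def)
      moreover have "restrict \<eta> K \<in> K \<rightarrow>\<^sub>E L"
        using \<eta>_in KG by auto
      ultimately show ?thesis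
        using tK unfolding s_def[symmetric] s_eq by blast
    qed
    ultimately show ?thesis
      by (auto intro: finite_subset[rotated])
  qed
  have "coarse_embedding \<Gamma> F"
    unfolding coarse_embedding_iff[OF \<Gamma>.group_axioms] using bornologous proper by blast
  then show ?thesis unfolding \<Gamma>_def by blast
qed

end
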